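(* Let $d\ge2$ and let $A\in L^1_{\mathrm{loc}}(\mathbb{R})^{d\times d}$ be such that the propagator of $y'=A(x)y$ is exponentially bounded on $\mathbb{R}$ and $y'=A(x)y$ has an exponential dichotomy $Q$ on $\mathbb{R}$. Suppose that for some $2\le d'\le d$ and $1\le k_0\le d'-1$ there is an exponential splitting $\{Q_j\}_{j=1}^{d'}$ on $\mathbb{R}$ with $Q=\sum_{j=1}^{k_0}Q_j$, $I_d-Q=\sum_{j=k_0+1}^{d'}Q_j$ and $\varkappa'(Q_j)\le\varkappa(Q_j)<\varkappa'(Q_{j+1})\le\varkappa(Q_{j+1})$ for $1\le j\le d'-1$. Let $\|R\|_{\mathbb{C}^{d\times d}}\in L^1(\mathbb{R})$. Then the Evans determinant $$D={\det}_{\mathbb{C}^d}(\mathcal{Y}_++\mathcal{Y}_-),\qquad\mathcal{Y}_+=\sum_{j=1}^{k_0}Y_+^{(j)}(0),\quad\mathcal{Y}_-=\sum_{j=k_0+1}^{d'}Y_-^{(j)}(0),$$ is independent of the choice of the generalized matrix-valued Jost solutions $Y_+^{(j)}$, $j=1,\dots,k_0$, and $Y_-^{(j)}$, $j=k_0+1,\dots,d'$, of $y'=(A(x)+R(x))y$ associated with $\{Q_j\}_{j=1}^{d'}$.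
   Context: $\mathbb{R}_+=[0,\infty)$, $\mathbb{R}_-=(-\infty,0]$, $\log0=-\infty$. $\Phi'=A\Phi$ a.e., $\Phi(0)=I_d$. The propagator is exponentially bounded on $\mathbb{R}$ if $\sup_{|x-x'|\le1}\|\Phi(x)\Phi(x')^{-1}\|<\infty$. A projection $Q$ in $\mathbb{C}^d$ is an exponential dichotomy on $\mathbb{R}$ if there are constants $\varkappa,\varkappa'>0$, $C,C'\ge1$ with $\|\Phi(x)Q\Phi(x')^{-1}\|\le Ce^{-\varkappa(x-x')}$ for $x\ge x'$ and $\|\Phi(x)(I_d-Q)\Phi(x')^{-1}\|\le C'e^{\varkappa'(x-x')}$ for $x\le x'$. Exponents: a projection $P$ is uniformly conjugated by $\Phi$ on $\mathbb{R}$ if $\sup_{x\in\mathbb{R}}\|\Phi(x)P\Phi(x)^{-1}\|<\infty$. For $J=\mathbb{R},\mathbb{R}_+,\mathbb{R}_-$, the upper (resp. lower) Bohl exponent of such $P$ on $J$ is the infimum (resp. supremum) of all $\varkappa\in\mathbb{R}$ for which there is a constant $C(\varkappa)$ with $\|\Phi(x)P\Phi(x')^{-1}\|\le C(\varkappa)e^{\varkappa(x-x')}$ for all $x,x'\in J$ with $x\ge x'$ (resp. $x\le x'$); it is denoted $\varkappa(P),\varkappa_+(P),\varkappa_-(P)$ (resp. $\varkappa'(P),\varkappa_+'(P),\varkappa_-'(P)$). An exponential splitting on $\mathbb{R}$ is a system of disjoint projections ($Q_iQ_j=0$, $i\neq j$) with sum $I_d$, each uniformly conjugated by $\Phi$ on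 $\mathbb{R}$, with pairwise disjoint Bohl segments $[\varkappa'(Q_j),\varkappa(Q_j)]$. Generalized matrix-valued Jost solutions associated with $\{Q_j\}_{j=1}^{d'}$: $d\times d$ matrix-valued solutions $Y_+^{(j)}$, $j=1,\dots,k_0$, on $\mathbb{R}_+$ and $Y_-^{(j)}$, $j=k_0+1,\dots,d'$, on $\mathbb{R}_-$ of $Y'=(A+R)Y$ with $$\limsup_{x\to\infty}x^{-1}\log\|Y_+^{(j)}(x)-\Phi(x)Q_j\|<\varkappa_+'(Q_j),\quad Y_+^{(j)}(0)=Y_+^{(j)}(0)Q_j,\quad j=1,\dots,k_0,$$ $$\liminf_{x\to-\infty}x^{-1}\log\|Y_-^{(j)}(x)-\Phi(x)Q_j\|>\varkappa_-(Q_j),\quad Y_-^{(j)}(0)=Y_-^{(j)}(0)Q_j,\quad j=k_0+1,\dots,d'.$$ *)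

theory Defs
  imports "HOL-Analysis.Analysis"
begin

text \<open>
  Matrices are measured by the library norm on \<^typ>\<open>complex^'n^'n\<close> (the Frobenius norm). All notions
  below are unchanged if it is replaced by an equivalent norm, such as an operator norm.
\<close>

text \<open>
  The elements of \<open>\<D>\<close> are non-overlapping compact intervals \<open>[a, b]\<close>, with \<open>a = Inf K\<close> and \<open>b = Sup K\<close>.
\<close>

definition abs_continuous_on :: "real set \<Rightarrow> (real \<Rightarrow> 'b::real_normed_vector) \<Rightarrow> bool" where
  "abs_continuous_on S f \<longleftrightarrow>
     (\<forall>\<epsilon>>0. \<exists>\<delta>>0. \<forall>\<D>. \<D> division_of \<Union>\<D> \<and> \<Union>\<D> \<subseteq> S \<and> (\<Sum>K\<in>\<D>. measure lborel K) < \<delta> \<longrightarrow>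
        (\<Sum>K\<in>\<D>. norm (f (Sup K) - f (Inf K))) < \<epsilon>)"

definition loc_abs_continuous_on :: "real set \<Rightarrow> (real \<Rightarrow> 'b::real_normed_vector) \<Rightarrow> bool" where
  "loc_abs_continuous_on J f \<longleftrightarrow> (\<forall>a b. {a..b} \<subseteq> J \<longrightarrow> abs_continuous_on {a..b} f)"

definition locally_integrable :: "(real \<Rightarrow> complex^'n^'n) \<Rightarrow> bool" where
  "locally_integrable A \<longleftrightarrow> (\<forall>a b. A absolutely_integrable_on {a..b})"

text \<open>Matrix-valued solutions on the interval \<open>J\<close>, in the sense of Caratheodory.\<close>

definition matrix_solution :: "(real \<Rightarrow> complex^'n^'n) \<Rightarrow> real set \<Rightarrow> (real \<Rightarrow> complex^'n^'n) \<Rightarrow> bool" where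
  "matrix_solution A J Y \<longleftrightarrow>
     loc_abs_continuous_on J Y \<and>
     (AE x in lebesgue. x \<in> J \<longrightarrow> (Y has_vector_derivative A x ** Y x) (at x within J))"

definition propagator :: "(real \<Rightarrow> complex^'n^'n) \<Rightarrow> (real \<Rightarrow> complex^'n^'n) \<Rightarrow> bool" where
  "propagator A \<Phi> \<longleftrightarrow> matrix_solution A UNIV \<Phi> \<and> \<Phi> 0 = mat 1"

definition exp_bounded :: "(real \<Rightarrow> complex^'n^'n) \<Rightarrow> bool" where
  "exp_bounded \<Phi> \<longleftrightarrow> bounded {\<Phi> x ** matrix_inv (\<Phi> x') | x x'. \<bar>x - x'\<bar> \<le> 1}"

definition is_projection :: "complex^'n^'n \<Rightarrow> bool" where
  "is_projection P \<longleftrightarrow> P ** P = P"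

definition exp_dichotomy :: "(real \<Rightarrow> complex^'n^'n) \<Rightarrow> complex^'n^'n \<Rightarrow> bool" where
  "exp_dichotomy \<Phi> Q \<longleftrightarrow> is_projection Q \<and>
     (\<exists>\<kappa>>0. \<exists>\<kappa>'>0. \<exists>C\<ge>1. \<exists>C'\<ge>1.
        (\<forall>x x'. x \<ge> x' \<longrightarrow> norm (\<Phi> x ** Q ** matrix_inv (\<Phi> x')) \<le> C * exp (- \<kappa> * (x - x'))) \<and>
        (\<forall>x x'. x \<le> x' \<longrightarrow>
           norm (\<Phi> x ** (mat 1 - Q) ** matrix_inv (\<Phi> x')) \<le> C' * exp (\<kappa>' * (x - x'))))"

definition unif_conjugated :: "(real \<Rightarrow> complex^'n^'n) \<Rightarrow> complex^'n^'n \<Rightarrow> bool" where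
  "unif_conjugated \<Phi> P \<longleftrightarrow> bounded (range (\<lambda>x. \<Phi> x ** P ** matrix_inv (\<Phi> x)))"

text \<open>
  The exponents are extended reals, so that no junk values of the real infimum or supremum occur. The
  zero projection has upper exponent \<open>-\<infinity>\<close> and lower exponent \<open>\<infinity>\<close>, hence an empty Bohl segment.
\<close>

definition upper_bohl :: "(real \<Rightarrow> complex^'n^'n) \<Rightarrow> real set \<Rightarrow> complex^'n^'n \<Rightarrow> ereal" where
  "upper_bohl \<Phi> J P = Inf (ereal ` {\<kappa>. \<exists>C. \<forall>x\<in>J. \<forall>x'\<in>J. x \<ge> x' \<longrightarrow>
      norm (\<Phi> x ** P ** matrix_inv (\<Phi> x')) \<le> C * exp (\<kappa> * (x - x'))})"

definition lower_bohl :: "(real \<Rightarrow> complex^'n^'n) \<Rightarrow> real set \<Rightarrow> complex^'n^'n \<Rightarrow> ereal" where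
  "lower_bohl \<Phi> J P = Sup (ereal ` {\<kappa>. \<exists>C. \<forall>x\<in>J. \<forall>x'\<in>J. x \<le> x' \<longrightarrow>
      norm (\<Phi> x ** P ** matrix_inv (\<Phi> x')) \<le> C * exp (\<kappa> * (x - x'))})"

definition exp_splitting :: "(real \<Rightarrow> complex^'n^'n) \<Rightarrow> nat set \<Rightarrow> (nat \<Rightarrow> complex^'n^'n) \<Rightarrow> bool" where
  "exp_splitting \<Phi> I Q \<longleftrightarrow>
     (\<forall>j\<in>I. is_projection (Q j)) \<and>
     (\<forall>i\<in>I. \<forall>j\<in>I. i \<noteq> j \<longrightarrow> Q i ** Q j = 0) \<and>
     (\<Sum>j\<in>I. Q j) = mat 1 \<and>
     (\<forall>j\<in>I. unif_conjugated \<Phi> (Q j)) \<and>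
     (\<forall>i\<in>I. \<forall>j\<in>I. i \<noteq> j \<longrightarrow>
        {lower_bohl \<Phi> UNIV (Q i)..upper_bohl \<Phi> UNIV (Q i)} \<inter>
        {lower_bohl \<Phi> UNIV (Q j)..upper_bohl \<Phi> UNIV (Q j)} = {})"

definition log_ereal :: "real \<Rightarrow> ereal" where
  "log_ereal r = (if r = 0 then - \<infinity> else ereal (ln r))"

text \<open>
  In the following two definitions \<open>A\<close> is the unperturbed coefficient, \<open>R\<close> the perturbation, \<open>\<Phi>\<close> the
  propagator of \<open>A\<close>, \<open>P\<close> a member of the splitting and \<open>Y\<close> a solution for \<open>A + R\<close>; the values of \<open>Y\<close>
  off the half-line are irrelevant.
\<close>

definition jost_plus ::
  "(real \<Rightarrow> complex^'n^'n) \<Rightarrow> (real \<Rightarrow> complex^'n^'n) \<Rightarrow> (real \<Rightarrow> complex^'n^'n) \<Rightarrow>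
   complex^'n^'n \<Rightarrow> (real \<Rightarrow> complex^'n^'n) \<Rightarrow> bool" where
  "jost_plus A R \<Phi> P Y \<longleftrightarrow>
     matrix_solution (\<lambda>x. A x + R x) {0..} Y \<and>
     Limsup at_top (\<lambda>x. ereal (1 / x) * log_ereal (norm (Y x - \<Phi> x ** P))) < lower_bohl \<Phi> {0..} P \<and>
     Y 0 = Y 0 ** P"

definition jost_minus ::
  "(real \<Rightarrow> complex^'n^'n) \<Rightarrow> (real \<Rightarrow> complex^'n^'n) \<Rightarrow> (real \<Rightarrow> complex^'n^'n) \<Rightarrow>
   complex^'n^'n \<Rightarrow> (real \<Rightarrow> complex^'n^'n) \<Rightarrow> bool" where
  "jost_minus A R \<Phi> P Y \<longleftrightarrow>
     matrix_solution (\<lambda>x. A x + R x) {..0} Y \<and>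
     Liminf at_bot (\<lambda>x. ereal (1 / x) * log_ereal (norm (Y x - \<Phi> x ** P))) > upper_bohl \<Phi> {..0} P \<and>
     Y 0 = Y 0 ** P"

definition jost_system ::
  "(real \<Rightarrow> complex^'n^'n) \<Rightarrow> (real \<Rightarrow> complex^'n^'n) \<Rightarrow> (real \<Rightarrow> complex^'n^'n) \<Rightarrow>
   (nat \<Rightarrow> complex^'n^'n) \<Rightarrow> nat \<Rightarrow> nat \<Rightarrow>
   (nat \<Rightarrow> real \<Rightarrow> complex^'n^'n) \<Rightarrow> (nat \<Rightarrow> real \<Rightarrow> complex^'n^'n) \<Rightarrow> bool" where
  "jost_system A R \<Phi> Q k\<^sub>0 d' Yp Ym \<longleftrightarrow>
     (\<forall>j\<in>{1..k\<^sub>0}. jost_plus A R \<Phi> (Q j) (Yp j)) \<and>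
     (\<forall>j\<in>{k\<^sub>0 + 1..d'}. jost_minus A R \<Phi> (Q j) (Ym j))"

definition evans_det ::
  "nat \<Rightarrow> nat \<Rightarrow> (nat \<Rightarrow> real \<Rightarrow> complex^'n^'n) \<Rightarrow> (nat \<Rightarrow> real \<Rightarrow> complex^'n^'n) \<Rightarrow> complex" where
  "evans_det k\<^sub>0 d' Yp Ym = det ((\<Sum>j=1..k\<^sub>0. Yp j 0) + (\<Sum>j=k\<^sub>0 + 1..d'. Ym j 0))"

end

theory Submission
  imports Defs
begin

text \<open>
  A solution of \<open>y' = (A + R) y\<close> on a half-line is controlled through \<open>v = \<Phi>\<^sup>-\<^sup>1 y\<close>, which satisfies
  \<open>v' = \<Phi>\<^sup>-\<^sup>1 R y\<close>. Let \<open>P\<close> be the sum of the members of the splitting below \<open>Q\<^sub>j\<close>. If \<open>y\<close> has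
  exponential order \<open>\<mu>\<close> strictly between the exponents of \<open>P\<close> and those of \<open>I - P\<close>, then \<open>P v\<close> is
  integrated from \<open>x\<^sub>0\<close> and \<open>(I - P) v\<close> from \<open>\<infinity>\<close>; for \<open>x\<^sub>0\<close> large the integral of \<open>\<parallel>R\<parallel>\<close> is so small that
  \<open>P v(x\<^sub>0) = 0\<close> forces \<open>y = 0\<close>. Consequently the difference of two Jost solutions for \<open>Q\<^sub>j\<close> is
  a combination of the Jost solutions below \<open>j\<close>, and passing from one system to another multiplies
  \<open>\<Y>\<^sub>+\<close> by a block unipotent matrix acting on the range of \<open>Q\<close>. The same holds for \<open>\<Y>\<^sub>-\<close> on the
  range of \<open>I - Q\<close> by reflection, so the Evans determinant is multiplied by \<open>1\<close>.
\<close>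

section \<open>Absolutely continuous functions\<close>

text \<open>The Jost condition sits at infinity, the determinant at 0, and a Jost solution is fixed
  only up to solutions of smaller growth, so a single value \<open>Y j 0\<close> may change with the
  choice. The strict inequality in the condition leaves room below the lower exponent of
  \<open>Q j\<close> for rates \<alpha> < \<mu> < \<beta>: the common leading term
  \<open>\<Phi> x ** Q j\<close> cancels in a difference of two Jost solutions, which therefore has
  order \<mu>, while the unperturbed parts of index at least j obey the bound with rate \<beta>.
  Smallness of the perturbation is available only far out, so solutions are compared at some
  \<open>x\<^sub>0\<close>, and uniqueness for the initial value problem carries the identities back
  to 0. No Jost solution is ever constructed. The lower members of one given system span the
  solutions in question, and their independence is read off from their leading terms. The
  coefficient obtained for index j has its image strictly below j; this triangular shape is what the
  determinant cannot see.\<close>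

lemma norm_vector_smult: "norm (c *s v) = norm c * norm v" for v :: "complex^'n"
  by (simp add: norm_vec_def norm_mult L2_set_right_distrib)

text \<open>Each row of the product combines the rows of \<open>B\<close> with coefficients from the
  same row of \<open>A\<close>, so Cauchy-Schwarz bounds it; the rows are then collected in the
  Frobenius norm.\<close>

lemma norm_matrix_matrix_mult_le: "norm (A ** B) \<le> norm A * norm B"
  for A :: "complex^'n^'m" and B :: "complex^'k^'n"
proof -
  have row: "norm ((A ** B) $ i) \<le> norm (A $ i) * norm B" for i
  proof -
    have "(A ** B) $ i = (\<Sum>j\<in>UNIV. A $ i $ j *s B $ j)"
      by (simp add: matrix_matrix_mult_def vec_eq_iff)
    also have "norm \<dots> \<le> (\<Sum>j\<in>UNIV. \<bar>norm (A $ i $ j)\<bar> * \<bar>norm (B $ j)\<bar>)"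
      by (rule order_trans[OF norm_sum]) (simp add: norm_vector_smult)
    also have "\<dots> \<le> norm (A $ i) * norm B"
      by (simp only: norm_vec_def[of "A $ i"] norm_vec_def[of B] L2_set_mult_ineq)
    finally show ?thesis .
  qed
  have "norm (A ** B) = L2_set (\<lambda>i. norm ((A ** B) $ i)) UNIV"
    by (simp add: norm_vec_def)
  also have "\<dots> \<le> L2_set (\<lambda>i. norm (A $ i) * norm B) UNIV"
    by (rule L2_set_mono) (use row in auto)
  also have "\<dots> = norm A * norm B"
    by (simp add: norm_vec_def[of A] L2_set_left_distrib)
  finally show ?thesis .
qed

lemma bounded_bilinear_matrix_matrix_mult:
  "bounded_bilinear ((**) :: complex^'n^'m \<Rightarrow> complex^'k^'n \<Rightarrow> complex^'k^'m)"
proof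
  show "(a + a') ** b = a ** b + a' ** b" "b' ** (c + c') = b' ** c + b' ** c'"
    for a a' b' :: "complex^'n^'m" and b c c' :: "complex^'k^'n"
    by (simp_all add: matrix_matrix_mult_def vec_eq_iff sum.distrib algebra_simps)
  show "(r *\<^sub>R a) ** b = r *\<^sub>R (a ** b)" "a ** (r *\<^sub>R b) = r *\<^sub>R (a ** b)"
    for r and a :: "complex^'n^'m" and b :: "complex^'k^'n"
    by (simp_all add: matrix_matrix_mult_def vec_eq_iff scaleR_sum_right)
  show "\<exists>K. \<forall>(a :: complex^'n^'m) (b :: complex^'k^'n). norm (a ** b) \<le> norm a * norm b * K"
    by (rule exI[of _ 1]) (simp add: norm_matrix_matrix_mult_le)
qed

interpretation mm: bounded_bilinear "(**) :: complex^'n^'n \<Rightarrow> complex^'n^'n \<Rightarrow> complex^'n^'n"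
  by (rule bounded_bilinear_matrix_matrix_mult)

text \<open>
  In a Riemann sum for a fine gauge, the tags in \<open>N\<close> contribute little because their intervals lie in
  an open set of small measure, where absolute continuity applies; the other tags are handled by the
  derivative, as for everywhere differentiable functions.
\<close>

lemma has_integral_abs_continuous:
  fixes f g :: "real \<Rightarrow> 'b::banach"
  assumes "a \<le> b" and ac: "abs_continuous_on {a..b} f" and N: "negligible N"
    and der: "\<And>x. x \<in> {a..b} - N \<Longrightarrow> (f has_vector_derivative g x) (at x within {a..b})"
  shows "(g has_integral f b - f a) {a..b}"
proof -
  \<comment> \<open>With value 0 on \<open>N\<close>, the bad tags contribute only increments of
    \<open>f\<close>. The uncontrolled values of \<open>g\<close> there are restored at the end by
    \<open>has_integral_spike\<close>.\<close>
  define h where "h x = (if x \<in> N then 0 else g x)" for x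
  have "(h has_integral (f b - f a)) {a..b}"
    unfolding has_integral[of h _ a b, unfolded box_real(2)]
  proof (intro allI impI)
    fix e :: real assume "e > 0"
    \<comment> \<open>Half of \<open>e\<close> is reserved for each kind of tag; the
      \<open>+ 1\<close> covers \<open>a = b\<close>.\<close>
    define e1 where "e1 = e / 2 / (b - a + 1)"
    have e1: "e1 > 0" "e1 * (b - a) < e / 2"
      using \<open>e > 0\<close> \<open>a \<le> b\<close> by (auto simp: e1_def field_simps)
    obtain \<delta> where "\<delta> > 0" and \<delta>: "\<And>\<D>. \<lbrakk>\<D> division_of \<Union>\<D>; \<Union>\<D> \<subseteq> {a..b};
        (\<Sum>K\<in>\<D>. measure lborel K) < \<delta>\<rbrakk> \<Longrightarrow> (\<Sum>K\<in>\<D>. norm (f (Sup K) - f (Inf K))) < e / 2"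
      using ac \<open>e > 0\<close> unfolding abs_continuous_on_def by (meson half_gt_zero)
    obtain T where T: "open T" "N \<subseteq> T" "T \<in> lmeasurable" "measure lebesgue T < \<delta>"
    proof -
      from N have "N \<in> sets lebesgue" "measure lebesgue N = 0" "N \<in> lmeasurable"
        by (auto simp: negligible_iff_measure)
      with \<open>\<delta> > 0\<close> obtain T where "open T" "N \<subseteq> T" "T - N \<in> lmeasurable" "emeasure lebesgue (T - N) < ennreal \<delta>"
        using sets_lebesgue_outer_open by metis
      moreover have "T = (T - N) \<union> N" using \<open>N \<subseteq> T\<close> by auto
      moreover have "measure lebesgue (T - N) < \<delta>"
        using \<open>emeasure lebesgue (T - N) < ennreal \<delta>\<close> \<open>T - N \<in> lmeasurable\<close> \<open>\<delta> > 0\<close>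
        by (simp add: emeasure_eq_measure2 ennreal_less_iff)
      moreover have "measure lebesgue ((T - N) \<union> N) \<le> measure lebesgue (T - N) + measure lebesgue N"
        using \<open>T - N \<in> lmeasurable\<close> \<open>N \<in> lmeasurable\<close> by (intro measure_Un_le) auto
      ultimately show ?thesis
        using that[of T] \<open>N \<in> lmeasurable\<close> \<open>measure lebesgue N = 0\<close> fmeasurable.Un[of "T - N" lebesgue N]
        by auto
    qed
    have "\<forall>x. \<exists>d>0. (x \<in> {a..b} - N \<longrightarrow>
         (\<forall>y\<in>{a..b}. norm (y-x) < d \<longrightarrow> norm (f y - f x - (y-x) *\<^sub>R g x) \<le> e1 * norm (y-x))) \<and>
         (x \<in> N \<longrightarrow> ball x d \<subseteq> T)"
    proof
      fix x
      show "\<exists>d>0. (x \<in> {a..b} - N \<longrightarrow>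
         (\<forall>y\<in>{a..b}. norm (y-x) < d \<longrightarrow> norm (f y - f x - (y-x) *\<^sub>R g x) \<le> e1 * norm (y-x))) \<and>
         (x \<in> N \<longrightarrow> ball x d \<subseteq> T)"
      proof (cases "x \<in> N")
        case True
        then show ?thesis using T(1,2) openE[of T x] by (metis Diff_iff subsetD)
      next
        case False
        show ?thesis
        proof (cases "x \<in> {a..b}")
          case True
          then show ?thesis
            using der[of x] False e1(1) unfolding has_vector_derivative_def has_derivative_within_alt
            by auto
        next
          case False
          then show ?thesis using \<open>x \<notin> N\<close> by (auto intro: exI[of _ 1])
        qed
      qed
    qed
    then obtain d where d: "\<And>x. 0 < d x"
      and d1: "\<And>x y. \<lbrakk>x \<in> {a..b} - N; y \<in> {a..b}; norm (y-x) < d x\<rbrakk>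
           \<Longrightarrow> norm (f y - f x - (y-x) *\<^sub>R g x) \<le> e1 * norm (y-x)"
      and d2: "\<And>x. x \<in> N \<Longrightarrow> ball x (d x) \<subseteq> T"
      by metis
    show "\<exists>\<gamma>. gauge \<gamma> \<and> (\<forall>\<D>. \<D> tagged_division_of {a..b} \<and> \<gamma> fine \<D> \<longrightarrow>
         norm ((\<Sum>(x, k)\<in>\<D>. measure lborel k *\<^sub>R h x) - (f b - f a)) < e)"
    proof (intro exI conjI allI impI)
      show "gauge (\<lambda>x. ball x (d x))"
        using d gauge_ball_dependent by blast
      fix p assume "p tagged_division_of {a..b} \<and> (\<lambda>x. ball x (d x)) fine p"
      then have ptag: "p tagged_division_of {a..b}" and fine: "(\<lambda>x. ball x (d x)) fine p" by auto
      have finp: "finite p" using ptag by blast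
      have ba: "b - a = (\<Sum>(x,K)\<in>p. Sup K - Inf K)" "f b - f a = (\<Sum>(x,K)\<in>p. f(Sup K) - f(Inf K))"
        using additive_tagged_division_1[where f= "\<lambda>x. x"] additive_tagged_division_1[where f= f]
            \<open>a \<le> b\<close> ptag by auto
      define p1 where "p1 = {q \<in> p. fst q \<notin> N}"
      define p2 where "p2 = {q \<in> p. fst q \<in> N}"
      have p12: "p = p1 \<union> p2" "p1 \<inter> p2 = {}" "finite p1" "finite p2" "p1 \<subseteq> p" "p2 \<subseteq> p"
        using finp by (auto simp: p1_def p2_def)
      let ?E = "\<lambda>(x, K). measure lborel K *\<^sub>R h x - (f (Sup K) - f (Inf K))"
      have "norm (\<Sum>q\<in>p1. ?E q) \<le> (\<Sum>q\<in>p1. e1 * (case q of (x, K) \<Rightarrow> Sup K - Inf K))"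
      proof (rule sum_norm_le, safe)
        fix x K
        assume xK: "(x, K) \<in> p1"
        then have "x \<in> K" and kab: "K \<subseteq> {a..b}" and "x \<notin> N" and xKp: "(x, K) \<in> p"
          using ptag by (auto simp: p1_def)
        then have "x \<in> {a..b} - N" by auto
        obtain u v where k: "K = cbox u v"
          using ptag xKp by blast
        have "u \<le> v"
          using \<open>x \<in> K\<close> unfolding k by auto
        have ball: "\<forall>y\<in>K. y \<in> ball x (d x)"
          using fine xKp by blast
        have uv: "u \<in> K" "v \<in> K"
          by (simp_all add: \<open>u \<le> v\<close> k)
        have "norm ((v - u) *\<^sub>R g x - (f v - f u)) = norm (f u - f x - (u - x) *\<^sub>R g x - (f v - f x - (v - x) *\<^sub>R g x))"
          by (auto simp: algebra_simps)
        also have "\<dots> \<le> norm (f u - f x - (u - x) *\<^sub>R g x) + norm (f v - f x - (v - x) *\<^sub>R g x)"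
          by (rule norm_triangle_ineq4)
        also have "\<dots> \<le> e1 * norm (u - x) + e1 * norm (v - x)"
          using d1[OF \<open>x \<in> {a..b} - N\<close>, of u] d1[OF \<open>x \<in> {a..b} - N\<close>, of v] uv ball kab
          by (intro add_mono) (auto simp: dist_real_def abs_minus_commute)
        also have "\<dots> \<le> e1 * (Sup K - Inf K)"
          using \<open>x \<in> K\<close> by (auto simp: k interval_bounds_real[OF \<open>u \<le> v\<close>] field_simps)
        finally show "norm (measure lborel K *\<^sub>R h x - (f (Sup K) - f (Inf K))) \<le> e1 * (Sup K - Inf K)"
          using \<open>u \<le> v\<close> \<open>x \<notin> N\<close> by (simp add: k h_def)
      qed
      also have "\<dots> \<le> (\<Sum>q\<in>p. e1 * (case q of (x, K) \<Rightarrow> Sup K - Inf K))"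
      proof (rule sum_mono2[OF finp \<open>p1 \<subseteq> p\<close>])
        fix q assume "q \<in> p - p1"
        then obtain x u v where q: "q = (x, cbox u v)" "x \<in> cbox u v"
          using ptag by (cases q) (metis DiffD1 tagged_division_ofD(2,4))
        then show "0 \<le> e1 * (case q of (x, K) \<Rightarrow> Sup K - Inf K)"
          using e1 by auto
      qed
      also have "\<dots> = e1 * (b - a)"
        by (simp add: ba(1) sum_distrib_left split_def)
      finally have E1: "norm (\<Sum>q\<in>p1. ?E q) < e / 2" using e1 by linarith
      define \<D> where "\<D> = snd ` p2"
      have p2t: "p2 tagged_division_of \<Union>(snd ` p2)"
      proof -
        have "p2 tagged_partial_division_of {a..b}"
          using ptag \<open>p2 \<subseteq> p\<close> tagged_partial_division_subset[of p "{a..b}" p2]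
          by (simp add: tagged_division_of_def)
        then show ?thesis
          by (rule tagged_partial_division_of_Union_self)
      qed
      have div: "\<D> division_of \<Union>\<D>"
        unfolding \<D>_def by (rule division_of_tagged_division[OF p2t])
      have sub: "\<Union>\<D> \<subseteq> {a..b}"
        using ptag \<open>p2 \<subseteq> p\<close> by (auto simp: \<D>_def dest!: tagged_division_ofD(3))
      have "(\<Sum>K\<in>\<D>. measure lborel K) = measure lebesgue (\<Union>\<D>)"
        unfolding content_division[OF div, symmetric]
        by (intro sum.cong refl) (metis div division_ofD(4) lborelD borel_closed closed_cbox measure_completion sets_lborel)
      also have "\<dots> \<le> measure lebesgue T"
      proof (rule measure_mono_fmeasurable[OF _ _ T(3)])
        show "\<Union>\<D> \<subseteq> T"
        proof
          fix y assume "y \<in> \<Union>\<D>"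
          then obtain x K where "(x, K) \<in> p" "x \<in> N" "y \<in> K"
            by (auto simp: \<D>_def p2_def)
          then have "y \<in> ball x (d x)" using fine by blast
          then show "y \<in> T" using d2[OF \<open>x \<in> N\<close>] by auto
        qed
        show "\<Union>\<D> \<in> sets lebesgue"
          using lmeasurable_division[OF div] by (rule fmeasurableD)
      qed
      also have "\<dots> < \<delta>" by (rule T(4))
      finally have small: "(\<Sum>K\<in>\<D>. norm (f (Sup K) - f (Inf K))) < e / 2"
        by (rule \<delta>[OF div sub])
      have "norm (\<Sum>q\<in>p2. ?E q) \<le> (\<Sum>q\<in>p2. norm (f (Sup (snd q)) - f (Inf (snd q))))"
        by (rule sum_norm_le) (auto simp: h_def p2_def norm_minus_commute)
      also have "\<dots> = (\<Sum>K\<in>\<D>. norm (f (Sup K) - f (Inf K)))"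
      proof -
        \<comment> \<open>Passing from tags to intervals loses repetitions, but an interval carrying
          two tags is degenerate, where \<open>m\<close> is 0. The empty interval needs its own case
          because \<open>Sup\<close> and \<open>Inf\<close> mean nothing there.\<close>
        define m where "m K = (if K = {} then 0 else norm (f (Sup K) - f (Inf K)))" for K
        have "m (cbox u v) = 0" if "box u v = {}" for u v :: real
          using that by (cases "u = v") (auto simp: m_def)
        then have "(\<Sum>q\<in>p2. m (snd q)) = (\<Sum>K\<in>\<D>. m K)"
          using sum.over_tagged_division_lemma[OF p2t, of m]
          by (simp add: split_def \<D>_def)
        moreover have "K \<noteq> {}" if "K \<in> \<D>" for K
          using division_ofD(3)[OF div that] .
        ultimately show ?thesis
          by (auto simp: m_def \<D>_def cong: sum.cong)
      qed
      finally have E2: "norm (\<Sum>q\<in>p2. ?E q) < e / 2" using small by linarith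
      have "(\<Sum>(x, k)\<in>p. measure lborel k *\<^sub>R h x) - (f b - f a) = (\<Sum>q\<in>p. ?E q)"
        unfolding ba(2) by (simp add: split_def sum_subtractf)
      also have "\<dots> = (\<Sum>q\<in>p1. ?E q) + (\<Sum>q\<in>p2. ?E q)"
        using p12 by (metis (no_types, lifting) sum.union_disjoint)
      finally show "norm ((\<Sum>(x, k)\<in>p. measure lborel k *\<^sub>R h x) - (f b - f a)) < e"
        using E1 E2 norm_triangle_ineq[of "\<Sum>q\<in>p1. ?E q" "\<Sum>q\<in>p2. ?E q"] by simp
    qed
  qed
  then show ?thesis
    by (rule has_integral_spike[OF N, rotated]) (auto simp: h_def)
qed

text \<open>Two dominating functions are allowed because an increment of a product is controlled by
  the increments of both factors; for the inverse both are the same.\<close>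

lemma abs_continuous_on_dominated:
  fixes f :: "real \<Rightarrow> 'a::real_normed_vector" and g :: "real \<Rightarrow> 'b::real_normed_vector"
    and h :: "real \<Rightarrow> 'c::real_normed_vector"
  assumes g: "abs_continuous_on S g" and h: "abs_continuous_on S h" and "K > 0"
    and dom: "\<And>u v. u \<in> S \<Longrightarrow> v \<in> S \<Longrightarrow> norm (f v - f u) \<le> K * (norm (g v - g u) + norm (h v - h u))"
  shows "abs_continuous_on S f"
  unfolding abs_continuous_on_def
proof (intro allI impI)
  fix \<epsilon> :: real assume "\<epsilon> > 0"
  then have e: "\<epsilon> / (2 * K) > 0" using \<open>K > 0\<close> by simp
  obtain d1 where "d1 > 0" and d1: "\<forall>\<D>. \<D> division_of \<Union>\<D> \<and> \<Union>\<D> \<subseteq> S \<and> (\<Sum>K\<in>\<D>. measure lborel K) < d1 \<longrightarrow>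
        (\<Sum>K\<in>\<D>. norm (g (Sup K) - g (Inf K))) < \<epsilon> / (2 * K)"
    using g[unfolded abs_continuous_on_def, rule_format, OF e] by blast
  obtain d2 where "d2 > 0" and d2: "\<forall>\<D>. \<D> division_of \<Union>\<D> \<and> \<Union>\<D> \<subseteq> S \<and> (\<Sum>K\<in>\<D>. measure lborel K) < d2 \<longrightarrow>
        (\<Sum>K\<in>\<D>. norm (h (Sup K) - h (Inf K))) < \<epsilon> / (2 * K)"
    using h[unfolded abs_continuous_on_def, rule_format, OF e] by blast
  show "\<exists>\<delta>>0. \<forall>\<D>. \<D> division_of \<Union>\<D> \<and> \<Union>\<D> \<subseteq> S \<and> (\<Sum>K\<in>\<D>. measure lborel K) < \<delta> \<longrightarrow>
        (\<Sum>K\<in>\<D>. norm (f (Sup K) - f (Inf K))) < \<epsilon>"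
  proof (intro exI[of _ "min d1 d2"] conjI allI impI)
    fix \<D> assume \<D>: "\<D> division_of \<Union>\<D> \<and> \<Union>\<D> \<subseteq> S \<and> (\<Sum>K\<in>\<D>. measure lborel K) < min d1 d2"
    have "(\<Sum>K\<in>\<D>. norm (f (Sup K) - f (Inf K)))
        \<le> (\<Sum>C\<in>\<D>. K * (norm (g (Sup C) - g (Inf C)) + norm (h (Sup C) - h (Inf C))))"
    proof (rule sum_mono)
      fix C assume C: "C \<in> \<D>"
      then obtain u v where uv: "C = cbox u v" "C \<noteq> {}"
        using \<D> division_ofD(3,4) by metis
      then have "u \<le> v" "Sup C \<in> C" "Inf C \<in> C" by auto
      then show "norm (f (Sup C) - f (Inf C)) \<le> K * (norm (g (Sup C) - g (Inf C)) + norm (h (Sup C) - h (Inf C)))"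
        using \<D> C by (intro dom) auto
    qed
    also have "\<dots> = K * ((\<Sum>C\<in>\<D>. norm (g (Sup C) - g (Inf C))) + (\<Sum>C\<in>\<D>. norm (h (Sup C) - h (Inf C))))"
      by (simp only: distrib_left sum.distrib sum_distrib_left)
    also have "\<dots> < K * (\<epsilon> / (2 * K) + \<epsilon> / (2 * K))"
      by (rule mult_strict_left_mono[OF add_strict_mono \<open>K > 0\<close>])
        (use d1[rule_format, of \<D>] d2[rule_format, of \<D>] \<D> in simp_all)
    also have "\<dots> = \<epsilon>" using \<open>K > 0\<close> by (simp add: field_simps)
    finally show "(\<Sum>K\<in>\<D>. norm (f (Sup K) - f (Inf K))) < \<epsilon>" .
  qed (simp add: \<open>d1 > 0\<close> \<open>d2 > 0\<close>)
qed

lemma abs_continuous_on_imp_continuous_on: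
  assumes "abs_continuous_on {a..b} f"
  shows "continuous_on {a..b} f"
  unfolding continuous_on_iff
proof (intro ballI allI impI)
  fix x e :: real assume x: "x \<in> {a..b}" and "e > 0"
  then obtain \<delta> where "\<delta> > 0" and \<delta>: "\<And>\<D>. \<D> division_of \<Union>\<D> \<and> \<Union>\<D> \<subseteq> {a..b} \<and>
      (\<Sum>K\<in>\<D>. measure lborel K) < \<delta> \<Longrightarrow> (\<Sum>K\<in>\<D>. norm (f (Sup K) - f (Inf K))) < e"
    using assms unfolding abs_continuous_on_def by meson
  have *: "norm (f v - f u) < e" if "u \<in> {a..b}" "v \<in> {a..b}" "u \<le> v" "v - u < \<delta>" for u v
  proof -
    have "{{u..v}} division_of \<Union>{{u..v}}"
      using division_of_self[of u v] that by simp
    then have "(\<Sum>K\<in>{{u..v}}. norm (f (Sup K) - f (Inf K))) < e"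
      by (intro \<delta>) (use that in simp)
    then show ?thesis using that by simp
  qed
  show "\<exists>d>0. \<forall>x'\<in>{a..b}. dist x' x < d \<longrightarrow> dist (f x') (f x) < e"
  proof (intro exI[of _ \<delta>] conjI ballI impI \<open>\<delta> > 0\<close>)
    fix y assume "y \<in> {a..b}" "dist y x < \<delta>"
    then show "dist (f y) (f x) < e"
      using *[of x y] *[of y x] x
      by (cases "x \<le> y") (simp_all add: dist_norm norm_minus_commute)
  qed
qed

text \<open>
  A Gronwall argument in integrated form; the zero at \<open>c\<close> propagates in both directions.
\<close>

lemma continuous_zero_propagation:
  fixes V :: "real \<Rightarrow> 'b::real_normed_vector"
  assumes cont: "continuous_on {a..b} V" and k: "k integrable_on {a..b}"
    and incr: "\<And>u v M. \<lbrakk>a \<le> u; u \<le> v; v \<le> b; \<And>t. t \<in> {u..v} \<Longrightarrow> norm (V t) \<le> M\<rbrakk>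
        \<Longrightarrow> norm (V v - V u) \<le> M * integral {u..v} k"
    and c: "c \<in> {a..b}" "V c = 0" and x: "x \<in> {a..b}"
  shows "V x = 0"
proof -
  define I where "I x = integral {a..x} k" for x
  have "uniformly_continuous_on {a..b} I"
    unfolding I_def by (intro compact_uniformly_continuous indefinite_integral_continuous_1 k) auto
  then obtain \<delta> where "\<delta> > 0" and \<delta>: "\<And>u v. u \<in> {a..b} \<Longrightarrow> v \<in> {a..b} \<Longrightarrow> dist v u < \<delta> \<Longrightarrow> dist (I v) (I u) < 1/2"
    unfolding uniformly_continuous_on_def by (metis half_gt_zero_iff zero_less_one)
  have I: "integral {u..v} k < 1/2" if "a \<le> u" "u \<le> v" "v \<le> b" "v - u < \<delta>" for u v
  proof -
    have "I u + integral {u..v} k = I v"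
      unfolding I_def using that k
      by (intro Henstock_Kurzweil_Integration.integral_combine) (auto intro: integrable_on_subinterval)
    then show ?thesis using \<delta>[of u v] that by (simp add: dist_real_def abs_if split: if_splits)
  qed
  \<comment> \<open>On a window where \<open>k\<close> integrates to less than 1/2, the maximum of
    \<open>norm (V t)\<close> is at most half of itself, so it is 0.\<close>
  have step: "V y = 0" if z: "z \<in> {a..b}" "V z = 0" and y: "y \<in> {a..b}" "\<bar>y - z\<bar> < \<delta>" for y z
  proof -
    define u where "u = min y z"
    define v where "v = max y z"
    have uv: "a \<le> u" "u \<le> v" "v \<le> b" "v - u < \<delta>" "y \<in> {u..v}" "z \<in> {u..v}"
      using z y by (auto simp: u_def v_def)
    have "continuous_on {u..v} (\<lambda>t. norm (V t))"
      using uv by (intro continuous_on_norm continuous_on_subset[OF cont]) auto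
    then obtain m where m: "m \<in> {u..v}" "\<And>t. t \<in> {u..v} \<Longrightarrow> norm (V t) \<le> norm (V m)"
      using continuous_attains_sup[of "{u..v}" "\<lambda>t. norm (V t)"] uv by auto
    have mz: "u \<le> min m z" "min m z \<le> max m z" "max m z \<le> v"
      using m(1) uv by simp_all
    have "norm (V (max m z) - V (min m z)) \<le> norm (V m) * integral {min m z..max m z} k"
    proof (rule incr)
      fix t assume "t \<in> {min m z..max m z}"
      then show "norm (V t) \<le> norm (V m)" using mz by (intro m(2)) (metis atLeastAtMost_iff order_trans)
    qed (use mz uv in linarith)+
    also have "\<dots> \<le> norm (V m) * (1/2)"
    proof (rule mult_left_mono)
      show "integral {min m z..max m z} k \<le> 1/2"
        by (rule less_imp_le, rule I) (use mz uv in linarith)+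
    qed simp
    also have "norm (V (max m z) - V (min m z)) = norm (V m)"
      using z by (cases "m \<le> z") auto
    finally have "norm (V m) \<le> 0" by simp
    with m(2)[OF uv(5)] show ?thesis by simp
  qed
  have "\<forall>y\<in>{a..b}. \<bar>y - c\<bar> \<le> real n * (\<delta> / 2) \<longrightarrow> V y = 0" for n
  proof (induction n)
    case 0
    then show ?case using c by auto
  next
    case (Suc n)
    show ?case
    proof (intro ballI impI)
      fix y assume y: "y \<in> {a..b}" "\<bar>y - c\<bar> \<le> real (Suc n) * (\<delta> / 2)"
      \<comment> \<open>This \<open>s\<close> makes \<open>z\<close> divide the segment from
        \<open>c\<close> to \<open>y\<close> in the ratio \<open>n\<close> to 1: \<open>z\<close> is
        within reach of the induction hypothesis and at most \<open>\<delta> / 2\<close> from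
        \<open>y\<close>.\<close>
      define s where "s = real n / real (Suc n)"
      have s: "0 \<le> s" "s \<le> 1" by (auto simp: s_def)
      define z where "z = (1 - s) * c + s * y"
      have "z \<in> {a..b}"
        using convexD[of "{a..b}" c y "1 - s" s] c y s by (simp add: z_def)
      have zc: "\<bar>z - c\<bar> = s * \<bar>y - c\<bar>" and yz: "\<bar>y - z\<bar> = (1 - s) * \<bar>y - c\<bar>"
      proof -
        have "z - c = s * (y - c)" "y - z = (1 - s) * (y - c)" by (auto simp: z_def algebra_simps)
        then show "\<bar>z - c\<bar> = s * \<bar>y - c\<bar>" "\<bar>y - z\<bar> = (1 - s) * \<bar>y - c\<bar>" using s by (auto simp: abs_mult)
      qed
      have "\<bar>z - c\<bar> \<le> s * (real (Suc n) * (\<delta> / 2))" unfolding zc using y s by (intro mult_left_mono) auto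
      also have "\<dots> = real n * (\<delta> / 2)" by (simp add: s_def field_simps)
      finally have "V z = 0" using Suc \<open>z \<in> {a..b}\<close> by auto
      have "\<bar>y - z\<bar> \<le> (1 - s) * (real (Suc n) * (\<delta> / 2))" unfolding yz using y s by (intro mult_left_mono) auto
      also have "\<dots> = \<delta> / 2" by (simp add: s_def field_simps)
      also have "\<dots> < \<delta>" using \<open>\<delta> > 0\<close> by simp
      finally show "V y = 0" using step[OF \<open>z \<in> {a..b}\<close> \<open>V z = 0\<close> y(1)] by simp
    qed
  qed
  moreover obtain n where "\<bar>x - c\<bar> / (\<delta> / 2) \<le> real n" using real_arch_simple by blast
  then have "\<bar>x - c\<bar> \<le> real n * (\<delta> / 2)" using \<open>\<delta> > 0\<close> by (simp add: field_simps)
  ultimately show ?thesis using x by blast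
qed

section \<open>Caratheodory solutions and variation of constants\<close>

lemma matrix_solution_continuous_on:
  "matrix_solution B J Y \<Longrightarrow> {a..b} \<subseteq> J \<Longrightarrow> continuous_on {a..b} Y"
  unfolding matrix_solution_def loc_abs_continuous_on_def
  by (blast intro: abs_continuous_on_imp_continuous_on)

lemma matrix_solution_derivative:
  assumes "matrix_solution B J Y"
  obtains N where "negligible N"
    "\<And>x S. x \<in> J - N \<Longrightarrow> S \<subseteq> J \<Longrightarrow> (Y has_vector_derivative B x ** Y x) (at x within S)"
proof -
  obtain N where "N \<in> null_sets lebesgue"
    and N: "{x. \<not> (x \<in> J \<longrightarrow> (Y has_vector_derivative B x ** Y x) (at x within J))} \<subseteq> N"
    using assms unfolding matrix_solution_def eventually_ae_filter by auto
  show ?thesis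
    by (rule that[of N]) (use N \<open>N \<in> null_sets lebesgue\<close> in
      \<open>auto simp: negligible_iff_null_sets intro: has_vector_derivative_within_subset\<close>)
qed

lemma matrix_solution_has_integral:
  assumes "matrix_solution B J Y" "a \<le> b" "{a..b} \<subseteq> J"
  shows "((\<lambda>x. B x ** Y x) has_integral Y b - Y a) {a..b}"
proof -
  obtain N where N: "negligible N"
    "\<And>x S. x \<in> J - N \<Longrightarrow> S \<subseteq> J \<Longrightarrow> (Y has_vector_derivative B x ** Y x) (at x within S)"
    using matrix_solution_derivative[OF assms(1)] by blast
  show ?thesis
  proof (rule has_integral_abs_continuous[OF assms(2) _ N(1)])
    show "abs_continuous_on {a..b} Y"
      using assms by (auto simp: matrix_solution_def loc_abs_continuous_on_def)
  qed (use N(2) assms(3) in blast)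
qed

text \<open>A kernel vector repeated in every column is a kernel matrix. Testing on matrices avoids
  vector-valued solutions throughout.\<close>

lemma invertible_if_trivial_kernel:
  fixes G :: "complex^'n^'n"
  assumes ker: "\<And>C :: complex^'n^'n. G ** C = 0 \<Longrightarrow> C = 0"
  shows "invertible G"
proof -
  have "v = 0" if v: "G *v v = 0" for v
  proof -
    have "G ** (\<chi> i j. v $ i) = 0"
      using v by (simp add: matrix_matrix_mult_def matrix_vector_mult_def vec_eq_iff)
    then have "(\<chi> i j. v $ i) = (0 :: complex^'n^'n)" by (rule ker)
    then show "v = 0" by (simp add: vec_eq_iff)
  qed
  then show ?thesis by (metis invertible_left_inverse matrix_left_invertible_ker)
qed

text \<open>If \<open>\<Phi> x ** C = 0\<close>, then \<open>\<Phi> t ** C\<close> satisfies the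
  same integrated equation and vanishes at \<open>x\<close>; the zero travels to 0, where the value
  is \<open>C\<close>.\<close>

lemma propagator_invertible:
  fixes A :: "real \<Rightarrow> complex^'n^'n"
  assumes A: "locally_integrable A" and \<Phi>: "propagator A \<Phi>"
  shows "invertible (\<Phi> x)"
proof -
  have sol: "matrix_solution A UNIV \<Phi>" and "\<Phi> 0 = mat 1" using \<Phi> by (auto simp: propagator_def)
  have zero: "C = 0" if "\<Phi> x ** C = 0" for C :: "complex^'n^'n"
  proof -
    define a where "a = min 0 x"
    define b where "b = max 0 x"
    have "\<Phi> 0 ** C = 0"
    proof (rule continuous_zero_propagation[of a b "\<lambda>t. \<Phi> t ** C" "\<lambda>t. norm (A t)" x 0])
      show "continuous_on {a..b} (\<lambda>t. \<Phi> t ** C)"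
        by (intro mm.continuous_on matrix_solution_continuous_on[OF sol] continuous_on_const) auto
      show "(\<lambda>t. norm (A t)) integrable_on {a..b}"
        using A by (simp add: locally_integrable_def absolutely_integrable_on_def)
      fix u v M assume uv: "a \<le> u" "u \<le> v" "v \<le> b" and M: "\<And>t. t \<in> {u..v} \<Longrightarrow> norm (\<Phi> t ** C) \<le> M"
      have "((\<lambda>t. (A t ** \<Phi> t) ** C) has_integral (\<Phi> v - \<Phi> u) ** C) {u..v}"
        using has_integral_linear[OF matrix_solution_has_integral[OF sol uv(2)] mm.bounded_linear_left[of C]]
        by (simp add: o_def)
      then have int: "((\<lambda>t. A t ** (\<Phi> t ** C)) has_integral \<Phi> v ** C - \<Phi> u ** C) {u..v}"
        by (simp add: matrix_mul_assoc mm.diff_left)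
      have "norm (integral {u..v} (\<lambda>t. A t ** (\<Phi> t ** C))) \<le> integral {u..v} (\<lambda>t. M * norm (A t))"
      proof (rule integral_norm_bound_integral)
        show "(\<lambda>t. M * norm (A t)) integrable_on {u..v}"
          using A by (simp add: integrable_on_mult_right locally_integrable_def absolutely_integrable_on_def)
        fix t assume "t \<in> {u..v}"
        then show "norm (A t ** (\<Phi> t ** C)) \<le> M * norm (A t)"
          using M[of t] order_trans[OF norm_matrix_matrix_mult_le mult_left_mono[of _ M "norm (A t)"]]
          by (simp add: mult.commute)
      qed (use int in blast)
      then show "norm (\<Phi> v ** C - \<Phi> u ** C) \<le> M * integral {u..v} (\<lambda>t. norm (A t))"
        using integral_unique[OF int] by simp
    qed (use that in \<open>auto simp: a_def b_def\<close>)
    then show "C = 0" using \<open>\<Phi> 0 = mat 1\<close> by simp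
  qed
  then show ?thesis by (rule invertible_if_trivial_kernel)
qed

section \<open>Inverses of matrix-valued functions\<close>

lemma matrix_inv:
  assumes "invertible A"
  shows "A ** matrix_inv A = mat 1" "matrix_inv A ** A = mat 1"
  using someI_ex[OF assms[unfolded invertible_def]] by (auto simp: matrix_inv_def)

text \<open>The resolvent identity, from which continuity, derivative and absolute continuity of the
  inverse are all derived.\<close>

lemma matrix_inv_diff:
  fixes X Y :: "complex^'n^'n"
  assumes "invertible X" "invertible Y"
  shows "matrix_inv Y - matrix_inv X = - (matrix_inv Y ** (Y - X) ** matrix_inv X)"
  using assms by (simp add: mm.diff_left mm.diff_right matrix_inv matrix_mul_assoc[symmetric])

lemma continuous_on_matrix_inv:
  fixes \<Phi> :: "real \<Rightarrow> complex^'n^'n"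
  assumes cont: "continuous_on S \<Phi>" and inv: "\<And>x. x \<in> S \<Longrightarrow> invertible (\<Phi> x)"
  shows "continuous_on S (\<lambda>x. matrix_inv (\<Phi> x))"
  unfolding continuous_on_def
proof
  fix x assume x: "x \<in> S"
  define c where "c = norm (matrix_inv (\<Phi> x))"
  have lim: "((\<lambda>y. norm (\<Phi> y - \<Phi> x)) \<longlongrightarrow> 0) (at x within S)"
    using cont x unfolding continuous_on_def by (metis LIM_zero tendsto_norm_zero)
  \<comment> \<open>The threshold below gives \<open>?d * c \<le> 1/2\<close>, so the term with
    \<open>?n\<close> in the resolvent estimate is absorbed into the left side and
    \<open>?n \<le> 2 * c\<close> results.\<close>
  have "c + 1 > 0" by (simp add: c_def add_nonneg_pos)
  then have "\<forall>\<^sub>F y in at x within S. norm (\<Phi> y - \<Phi> x) < 1 / (2 * (c + 1))"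
    by (intro order_tendstoD(2)[OF lim]) simp
  moreover have "\<forall>\<^sub>F y in at x within S. y \<in> S"
    by (simp add: eventually_at_filter)
  ultimately have "\<forall>\<^sub>F y in at x within S.
      norm (matrix_inv (\<Phi> y) - matrix_inv (\<Phi> x)) \<le> 2 * c * norm (\<Phi> y - \<Phi> x) * c"
  proof eventually_elim
    case (elim y)
    let ?n = "norm (matrix_inv (\<Phi> y))" and ?d = "norm (\<Phi> y - \<Phi> x)"
    have d: "?d * c \<le> 1/2"
    proof -
      have "?d * c \<le> 1 / (2 * (c + 1)) * (c + 1)"
        using elim by (intro mult_mono) (auto simp: c_def)
      also have "\<dots> = 1/2" using \<open>c + 1 > 0\<close> by (simp add: field_simps)
      finally show ?thesis .
    qed
    have b: "norm (matrix_inv (\<Phi> y) - matrix_inv (\<Phi> x)) \<le> ?n * ?d * c"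
      unfolding matrix_inv_diff[OF inv[OF x] inv[OF elim(2)]] norm_minus_cancel c_def
      by (meson norm_matrix_matrix_mult_le order_trans mult_right_mono norm_ge_zero)
    have "?n \<le> c + norm (matrix_inv (\<Phi> y) - matrix_inv (\<Phi> x))"
      unfolding c_def by (metis add.commute diff_add_cancel norm_triangle_ineq)
    also have "\<dots> \<le> c + ?n * (?d * c)" using b by simp
    also have "\<dots> \<le> c + ?n * (1/2)" using d by (intro add_left_mono mult_left_mono) auto
    finally have "?n \<le> 2 * c" by simp
    then have "?n * ?d * c \<le> 2 * c * ?d * c"
      by (intro mult_right_mono) (auto simp: c_def)
    with b show ?case by linarith
  qed
  moreover have "((\<lambda>y. 2 * c * norm (\<Phi> y - \<Phi> x) * c) \<longlongrightarrow> 0) (at x within S)"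
    using tendsto_mult_left[OF tendsto_mult_right[OF lim, of "c"], of "2 * c"] by (simp add: ac_simps)
  ultimately have "((\<lambda>y. matrix_inv (\<Phi> y) - matrix_inv (\<Phi> x)) \<longlongrightarrow> 0) (at x within S)"
    by (rule Lim_null_comparison)
  then show "((\<lambda>x. matrix_inv (\<Phi> x)) \<longlongrightarrow> matrix_inv (\<Phi> x)) (at x within S)"
    by (rule LIM_zero_cancel)
qed

text \<open>With derivatives as limits of quotients, the inverse can be differentiated by dividing
  the resolvent identity by \<open>y - x\<close>.\<close>

lemma has_vector_derivative_iff_tendsto:
  "(f has_vector_derivative D) (at x within S) \<longleftrightarrow>
    ((\<lambda>y. (f y - f x) /\<^sub>R (y - x)) \<longlongrightarrow> D) (at x within S)"
proof -
  have "((\<lambda>y. norm ((1 / norm (y - x)) *\<^sub>R (f y - (f x + (y - x) *\<^sub>R D)))) \<longlongrightarrow> 0) (at x within S) \<longleftrightarrow>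
    ((\<lambda>y. norm ((f y - f x) /\<^sub>R (y - x) - D)) \<longlongrightarrow> 0) (at x within S)"
  proof (rule Lim_cong_within[OF refl refl refl])
    fix y assume "y \<noteq> x"
    then have "(f y - f x) /\<^sub>R (y - x) - D = (f y - (f x + (y - x) *\<^sub>R D)) /\<^sub>R (y - x)"
      by (simp add: scaleR_diff_right scaleR_add_right)
    then show "norm ((1 / norm (y - x)) *\<^sub>R (f y - (f x + (y - x) *\<^sub>R D))) = norm ((f y - f x) /\<^sub>R (y - x) - D)"
      by (simp add: divide_inverse)
  qed
  then show ?thesis
    unfolding has_vector_derivative_def has_derivative_within tendsto_norm_zero_iff LIM_zero_iff
    by (simp add: bounded_linear_scaleR_left)
qed

lemma has_vector_derivative_matrix_inv:
  fixes \<Phi> :: "real \<Rightarrow> complex^'n^'n"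
  assumes cont: "continuous_on S \<Phi>" and inv: "\<And>x. x \<in> S \<Longrightarrow> invertible (\<Phi> x)" and x: "x \<in> S"
    and der: "(\<Phi> has_vector_derivative D) (at x within S)"
  shows "((\<lambda>y. matrix_inv (\<Phi> y)) has_vector_derivative - (matrix_inv (\<Phi> x) ** D ** matrix_inv (\<Phi> x))) (at x within S)"
  unfolding has_vector_derivative_iff_tendsto
proof (rule Lim_transform_eventually)
  have "((\<lambda>y. matrix_inv (\<Phi> y)) \<longlongrightarrow> matrix_inv (\<Phi> x)) (at x within S)"
    using continuous_on_matrix_inv[OF cont inv] x by (simp add: continuous_on_def)
  then show "((\<lambda>y. - (matrix_inv (\<Phi> y) ** ((\<Phi> y - \<Phi> x) /\<^sub>R (y - x)) ** matrix_inv (\<Phi> x)))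
      \<longlongrightarrow> - (matrix_inv (\<Phi> x) ** D ** matrix_inv (\<Phi> x))) (at x within S)"
    using der[unfolded has_vector_derivative_iff_tendsto]
    by (intro tendsto_minus mm.tendsto tendsto_const)
  show "\<forall>\<^sub>F y in at x within S. - (matrix_inv (\<Phi> y) ** ((\<Phi> y - \<Phi> x) /\<^sub>R (y - x)) ** matrix_inv (\<Phi> x))
      = (matrix_inv (\<Phi> y) - matrix_inv (\<Phi> x)) /\<^sub>R (y - x)"
    unfolding eventually_at_filter
    by (intro always_eventually allI impI)
      (simp add: matrix_inv_diff[OF inv[OF x] inv] mm.scaleR_left mm.scaleR_right)
qed

section \<open>Absolute continuity of products and inverses, and variation of constants\<close>

lemma norm_matrix_mult_diff_le:
  fixes F G :: "real \<Rightarrow> complex^'n^'n"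
  shows "norm (F v ** G v - F u ** G u) \<le> norm (F v) * norm (G v - G u) + norm (F v - F u) * norm (G u)"
proof -
  have "F v ** G v - F u ** G u = F v ** (G v - G u) + (F v - F u) ** G u"
    by (simp add: mm.diff_left mm.diff_right)
  also have "norm \<dots> \<le> norm (F v) * norm (G v - G u) + norm (F v - F u) * norm (G u)"
    by (intro norm_triangle_le add_mono norm_matrix_matrix_mult_le)
  finally show ?thesis .
qed

lemma continuous_on_Icc_bounded:
  fixes f :: "real \<Rightarrow> 'b::real_normed_vector"
  assumes "continuous_on {a..b} f"
  obtains B where "B > 0" "\<And>x. x \<in> {a..b} \<Longrightarrow> norm (f x) \<le> B"
  using compact_imp_bounded[OF compact_continuous_image[OF assms]]
  by (auto simp: bounded_pos)

lemma abs_continuous_on_matrix_mult: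
  fixes F G :: "real \<Rightarrow> complex^'n^'n"
  assumes F: "abs_continuous_on {a..b} F" and G: "abs_continuous_on {a..b} G"
  shows "abs_continuous_on {a..b} (\<lambda>x. F x ** G x)"
proof -
  obtain B where B: "B > 0" "\<And>x. x \<in> {a..b} \<Longrightarrow> norm (F x) \<le> B"
    using continuous_on_Icc_bounded[OF abs_continuous_on_imp_continuous_on[OF F]] by blast
  obtain C where C: "C > 0" "\<And>x. x \<in> {a..b} \<Longrightarrow> norm (G x) \<le> C"
    using continuous_on_Icc_bounded[OF abs_continuous_on_imp_continuous_on[OF G]] by blast
  show ?thesis
  proof (rule abs_continuous_on_dominated[OF F G, of "B + C"])
    fix u v assume "u \<in> {a..b}" "v \<in> {a..b}"
    then have "norm (F v) * norm (G v - G u) + norm (F v - F u) * norm (G u)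
        \<le> (B + C) * norm (G v - G u) + norm (F v - F u) * (B + C)"
      using B(2)[of v] C(2)[of u] B(1) C(1) by (intro add_mono mult_right_mono mult_left_mono) auto
    then show "norm (F v ** G v - F u ** G u) \<le> (B + C) * (norm (F v - F u) + norm (G v - G u))"
      using norm_matrix_mult_diff_le[of F v G u] by (simp add: algebra_simps)
  qed (use B C in auto)
qed

lemma abs_continuous_on_matrix_inv:
  fixes \<Phi> :: "real \<Rightarrow> complex^'n^'n"
  assumes \<Phi>: "abs_continuous_on {a..b} \<Phi>" and inv: "\<And>x. x \<in> {a..b} \<Longrightarrow> invertible (\<Phi> x)"
  shows "abs_continuous_on {a..b} (\<lambda>x. matrix_inv (\<Phi> x))"
proof -
  obtain B where B: "B > 0" "\<And>x. x \<in> {a..b} \<Longrightarrow> norm (matrix_inv (\<Phi> x)) \<le> B"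
    using continuous_on_Icc_bounded[OF continuous_on_matrix_inv[OF abs_continuous_on_imp_continuous_on[OF \<Phi>] inv]]
    by blast
  show ?thesis
  proof (rule abs_continuous_on_dominated[OF \<Phi> \<Phi>, of "B * B"])
    fix u v assume uv: "u \<in> {a..b}" "v \<in> {a..b}"
    have "norm (matrix_inv (\<Phi> v) - matrix_inv (\<Phi> u))
        \<le> norm (matrix_inv (\<Phi> v)) * norm (\<Phi> v - \<Phi> u) * norm (matrix_inv (\<Phi> u))"
      unfolding matrix_inv_diff[OF inv[OF uv(1)] inv[OF uv(2)]] norm_minus_cancel
      by (meson norm_matrix_matrix_mult_le order_trans mult_right_mono norm_ge_zero)
    also have "\<dots> \<le> B * norm (\<Phi> v - \<Phi> u) * B"
      using B uv by (intro mult_mono) auto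
    also have "\<dots> \<le> B * B * (norm (\<Phi> v - \<Phi> u) + norm (\<Phi> v - \<Phi> u))"
      using B by (simp add: algebra_simps)
    finally show "norm (matrix_inv (\<Phi> v) - matrix_inv (\<Phi> u))
        \<le> B * B * (norm (\<Phi> v - \<Phi> u) + norm (\<Phi> v - \<Phi> u))" .
  qed (use B in auto)
qed

text \<open>In the product rule the two terms with \<open>A\<close> cancel almost everywhere.
  Integrability of the remaining integrand needs no estimate: it comes from the absolute continuity
  of the primitive.\<close>

lemma variation_of_constants:
  fixes A R \<Phi> W :: "real \<Rightarrow> complex^'n^'n"
  assumes \<Phi>: "matrix_solution A UNIV \<Phi>" and inv: "\<And>x. invertible (\<Phi> x)"
    and W: "matrix_solution (\<lambda>x. A x + R x) J W" and ab: "a \<le> b" "{a..b} \<subseteq> J"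
  shows "((\<lambda>t. matrix_inv (\<Phi> t) ** R t ** W t) has_integral
    matrix_inv (\<Phi> b) ** W b - matrix_inv (\<Phi> a) ** W a) {a..b}"
proof -
  have ac: "abs_continuous_on {a..b} \<Phi>" "abs_continuous_on {a..b} W"
    using \<Phi> W ab by (auto simp: matrix_solution_def loc_abs_continuous_on_def)
  obtain N where N: "negligible N"
    "\<And>x S. x \<in> UNIV - N \<Longrightarrow> S \<subseteq> UNIV \<Longrightarrow> (\<Phi> has_vector_derivative A x ** \<Phi> x) (at x within S)"
    using matrix_solution_derivative[OF \<Phi>] by blast
  obtain N' where N': "negligible N'"
    "\<And>x S. x \<in> J - N' \<Longrightarrow> S \<subseteq> J \<Longrightarrow> (W has_vector_derivative (A x + R x) ** W x) (at x within S)"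
    using matrix_solution_derivative[OF W] by blast
  show ?thesis
  proof (rule has_integral_abs_continuous[OF ab(1)])
    show "abs_continuous_on {a..b} (\<lambda>t. matrix_inv (\<Phi> t) ** W t)"
      by (intro abs_continuous_on_matrix_mult abs_continuous_on_matrix_inv ac inv)
    show "negligible (N \<union> N')" using N N' by auto
    fix x assume x: "x \<in> {a..b} - (N \<union> N')"
    have dPhi: "((\<lambda>t. matrix_inv (\<Phi> t)) has_vector_derivative
        - (matrix_inv (\<Phi> x) ** (A x ** \<Phi> x) ** matrix_inv (\<Phi> x))) (at x within {a..b})"
      using x by (intro has_vector_derivative_matrix_inv inv N(2) abs_continuous_on_imp_continuous_on ac) auto
    have dW: "(W has_vector_derivative (A x + R x) ** W x) (at x within {a..b})"
      using x ab by (intro N'(2)) auto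
    have "matrix_inv (\<Phi> x) ** ((A x + R x) ** W x)
        + - (matrix_inv (\<Phi> x) ** (A x ** \<Phi> x) ** matrix_inv (\<Phi> x)) ** W x
        = matrix_inv (\<Phi> x) ** R x ** W x"
    proof -
      have "matrix_inv (\<Phi> x) ** (A x ** \<Phi> x) ** matrix_inv (\<Phi> x) = matrix_inv (\<Phi> x) ** A x"
        by (metis matrix_inv(1)[OF inv] matrix_mul_assoc matrix_mul_rid)
      then show ?thesis
        by (simp add: mm.add_left mm.add_right mm.minus_left matrix_mul_assoc)
    qed
    with mm.has_vector_derivative[OF dPhi dW]
    show "((\<lambda>t. matrix_inv (\<Phi> t) ** W t) has_vector_derivative matrix_inv (\<Phi> x) ** R x ** W x) (at x within {a..b})"
      by simp
  qed
qed

section \<open>Perturbed solutions on a half-line\<close>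

text \<open>The bound is only eventual, which is what a \<open>Limsup\<close> provides;
  \<open>sol_exp_bound\<close> extends it to the half-line. The sign of \<open>C\<close> is left
  open, hence the absolute value in \<open>exp_order_mono\<close>.\<close>

definition exp_order :: "real \<Rightarrow> (real \<Rightarrow> 'a::real_normed_vector) \<Rightarrow> bool" where
  "exp_order \<mu> F \<longleftrightarrow> (\<exists>C. \<forall>\<^sub>F x in at_top. norm (F x) \<le> C * exp (\<mu> * x))"

lemma exp_orderI: "(\<And>x. x \<ge> 0 \<Longrightarrow> norm (F x) \<le> C * exp (\<mu> * x)) \<Longrightarrow> exp_order \<mu> F"
  unfolding exp_order_def by (intro exI[of _ C] eventually_at_top_linorderI[of 0]) auto

lemma exp_order_zero [simp]: "exp_order \<mu> (\<lambda>x. 0)"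
  by (rule exp_orderI[where C = 0]) simp

lemma exp_order_mono:
  assumes F: "exp_order \<mu> F" and "\<mu> \<le> \<nu>"
  shows "exp_order \<nu> F"
proof -
  obtain C where C: "\<forall>\<^sub>F x in at_top. norm (F x) \<le> C * exp (\<mu> * x)"
    using F unfolding exp_order_def by blast
  have "\<forall>\<^sub>F x in at_top. norm (F x) \<le> \<bar>C\<bar> * exp (\<nu> * x)"
    using C eventually_ge_at_top[of 0]
  proof eventually_elim
    case (elim x)
    have "C * exp (\<mu> * x) \<le> \<bar>C\<bar> * exp (\<nu> * x)"
      using elim(2) \<open>\<mu> \<le> \<nu>\<close> by (intro mult_mono) (auto intro: mult_right_mono)
    with elim(1) show ?case by linarith
  qed
  then show ?thesis unfolding exp_order_def by blast
qed

lemma exp_order_add: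
  assumes F: "exp_order \<mu> F" and G: "exp_order \<mu> G"
  shows "exp_order \<mu> (\<lambda>x. F x + G x)"
proof -
  obtain C where C: "\<forall>\<^sub>F x in at_top. norm (F x) \<le> C * exp (\<mu> * x)"
    using F unfolding exp_order_def by blast
  obtain D where D: "\<forall>\<^sub>F x in at_top. norm (G x) \<le> D * exp (\<mu> * x)"
    using G unfolding exp_order_def by blast
  have "\<forall>\<^sub>F x in at_top. norm (F x + G x) \<le> (C + D) * exp (\<mu> * x)"
    using C D
  proof eventually_elim
    case (elim x)
    then show ?case using norm_triangle_ineq[of "F x" "G x"] by (simp add: distrib_right)
  qed
  then show ?thesis unfolding exp_order_def by blast
qed

lemma exp_order_uminus: "exp_order \<mu> F \<Longrightarrow> exp_order \<mu> (\<lambda>x. - F x)"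
  by (simp add: exp_order_def)

lemma exp_order_diff: "exp_order \<mu> F \<Longrightarrow> exp_order \<mu> G \<Longrightarrow> exp_order \<mu> (\<lambda>x. F x - G x)"
  using exp_order_add[of \<mu> F "\<lambda>x. - G x"] exp_order_uminus[of \<mu> G] by simp

lemma exp_order_sum: "(\<And>i. i \<in> I \<Longrightarrow> exp_order \<mu> (F i)) \<Longrightarrow> exp_order \<mu> (\<lambda>x. \<Sum>i\<in>I. F i x)"
  by (induction I rule: infinite_finite_induct) (auto intro: exp_order_add)

lemma exp_order_matrix_mult_right:
  fixes F :: "real \<Rightarrow> complex^'n^'n"
  assumes F: "exp_order \<mu> F"
  shows "exp_order \<mu> (\<lambda>x. F x ** M)"
proof -
  obtain C where C: "\<forall>\<^sub>F x in at_top. norm (F x) \<le> C * exp (\<mu> * x)"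
    using F unfolding exp_order_def by blast
  have "\<forall>\<^sub>F x in at_top. norm (F x ** M) \<le> (C * norm M) * exp (\<mu> * x)"
    using C
  proof eventually_elim
    case (elim x)
    have "norm (F x ** M) \<le> norm (F x) * norm M" by (rule norm_matrix_matrix_mult_le)
    also have "\<dots> \<le> C * exp (\<mu> * x) * norm M" using elim by (rule mult_right_mono) simp
    finally show ?case by (simp add: ac_simps)
  qed
  then show ?thesis unfolding exp_order_def by blast
qed

text \<open>The usual argument takes the best constant and finds it at most half of itself.
  Iterating the improvement avoids forming that supremum.\<close>

lemma halving_bounds_imp_zero:
  fixes F :: "real \<Rightarrow> 'a::real_normed_vector"
  assumes half: "\<And>M. (\<And>x. x \<in> S \<Longrightarrow> norm (F x) \<le> M * w x) \<Longrightarrow> (\<And>x. x \<in> S \<Longrightarrow> norm (F x) \<le> M / 2 * w x)"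
    and bound: "\<And>x. x \<in> S \<Longrightarrow> norm (F x) \<le> M * w x" and x: "x \<in> S"
  shows "F x = 0"
proof -
  have *: "\<forall>x\<in>S. norm (F x) \<le> M * (1/2) ^ n * w x" for n
  proof (induction n)
    case (Suc n)
    then show ?case using half[of "M * (1/2) ^ n"] by auto
  qed (use bound in simp)
  have "(\<lambda>n. M * (1/2) ^ n * w x) \<longlonglongrightarrow> M * 0 * w x"
    by (intro tendsto_mult tendsto_const LIMSEQ_realpow_zero) auto
  then have "norm (F x) \<le> M * 0 * w x"
    by (rule tendsto_lowerbound) (use * x in auto)
  then show ?thesis by simp
qed

text \<open>
  Solutions enter only through the integrated variation of constants formula, without the
  coefficient \<open>A\<close>. This form is stable under \<open>x \<mapsto> -x\<close>, so that \<open>{..0}\<close> needs no separate treatment.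
\<close>

locale half_line =
  fixes \<Phi> R :: "real \<Rightarrow> complex^'n^'n"
  assumes inv: "\<And>x. x \<ge> 0 \<Longrightarrow> invertible (\<Phi> x)"
    and cont: "\<And>b. continuous_on {0..b} \<Phi>"
    and start: "\<Phi> 0 = mat 1"
    and R: "(\<lambda>t. norm (R t)) integrable_on {0..}"
begin

abbreviation "\<Psi> x \<equiv> matrix_inv (\<Phi> x)"

definition sol :: "(real \<Rightarrow> complex^'n^'n) \<Rightarrow> bool" where
  "sol W \<longleftrightarrow> (\<forall>b. continuous_on {0..b} W) \<and>
    (\<forall>a b. 0 \<le> a \<longrightarrow> a \<le> b \<longrightarrow>
      ((\<lambda>t. \<Psi> t ** R t ** W t) has_integral \<Psi> b ** W b - \<Psi> a ** W a) {a..b})"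

lemma sol_continuous_on: "sol W \<Longrightarrow> continuous_on {0..b} W"
  by (simp add: sol_def)

lemma sol_has_integral:
  "sol W \<Longrightarrow> 0 \<le> a \<Longrightarrow> a \<le> b \<Longrightarrow>
    ((\<lambda>t. \<Psi> t ** R t ** W t) has_integral \<Psi> b ** W b - \<Psi> a ** W a) {a..b}"
  by (simp add: sol_def)

lemma sol_zero: "sol (\<lambda>x. 0)"
  by (simp add: sol_def)

lemma sol_add:
  assumes V: "sol V" and W: "sol W"
  shows "sol (\<lambda>x. V x + W x)"
  unfolding sol_def
proof (intro conjI allI impI)
  show "continuous_on {0..b} (\<lambda>x. V x + W x)" for b
    by (intro continuous_on_add sol_continuous_on V W)
  fix a b :: real assume "0 \<le> a" "a \<le> b"
  from has_integral_add[OF sol_has_integral[OF V this] sol_has_integral[OF W this]]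
  show "((\<lambda>t. \<Psi> t ** R t ** (V t + W t)) has_integral \<Psi> b ** (V b + W b) - \<Psi> a ** (V a + W a)) {a..b}"
    by (simp add: mm.add_right algebra_simps)
qed

lemma sol_mult_right:
  assumes W: "sol W"
  shows "sol (\<lambda>x. W x ** M)"
  unfolding sol_def
proof (intro conjI allI impI)
  show "continuous_on {0..b} (\<lambda>x. W x ** M)" for b
    by (intro mm.continuous_on continuous_on_const sol_continuous_on W)
  fix a b :: real assume "0 \<le> a" "a \<le> b"
  from has_integral_linear[OF sol_has_integral[OF W this] mm.bounded_linear_left[of M]]
  show "((\<lambda>t. \<Psi> t ** R t ** (W t ** M)) has_integral \<Psi> b ** (W b ** M) - \<Psi> a ** (W a ** M)) {a..b}"
    by (simp add: o_def mm.diff_left matrix_mul_assoc)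
qed

lemma sol_diff:
  assumes V: "sol V" and W: "sol W"
  shows "sol (\<lambda>x. V x - W x)"
  using sol_add[OF V sol_mult_right[OF W, of "- mat 1"]] by (simp add: mm.minus_right)

lemma sol_sum: "(\<And>i. i \<in> I \<Longrightarrow> sol (F i)) \<Longrightarrow> sol (\<lambda>x. \<Sum>i\<in>I. F i x)"
  by (induction I rule: infinite_finite_induct) (auto intro: sol_add sol_zero)

lemma R_integrable_Icc: "0 \<le> u \<Longrightarrow> (\<lambda>t. norm (R t)) integrable_on {u..v}"
  by (rule integrable_on_subinterval[OF R]) auto

text \<open>The primitive of \<open>norm (R t)\<close> from 0 is monotone and bounded; past a point
  where it is within \<open>\<epsilon>\<close> of its supremum, no interval can collect more than
  \<open>\<epsilon>\<close>.\<close>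

lemma integral_R_tail:
  assumes "\<epsilon> > 0"
  obtains x\<^sub>0 where "x\<^sub>0 \<ge> 0" "\<And>u v. x\<^sub>0 \<le> u \<Longrightarrow> u \<le> v \<Longrightarrow> integral {u..v} (\<lambda>t. norm (R t)) \<le> \<epsilon>"
proof -
  define F where "F v = integral {0..v} (\<lambda>t. norm (R t))" for v
  have bdd: "bdd_above (F ` {0..})"
    unfolding F_def
    by (intro bdd_aboveI2[of _ _ "integral {0..} (\<lambda>t. norm (R t))"] integral_subset_le R R_integrable_Icc) auto
  then obtain x0 where x0: "x0 \<ge> 0" "F x0 > Sup (F ` {0..}) - \<epsilon>"
    using less_cSup_iff[of "F ` {0..}" "Sup (F ` {0..}) - \<epsilon>"] \<open>\<epsilon> > 0\<close> by auto
  show thesis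
  proof (rule that[OF x0(1)])
    fix u v assume uv: "x0 \<le> u" "u \<le> v"
    have "F x0 \<le> F u"
      unfolding F_def using uv x0 by (intro integral_subset_le R_integrable_Icc) auto
    moreover have "F v \<le> Sup (F ` {0..})"
      using bdd uv x0 by (intro cSup_upper) auto
    moreover have "F u + integral {u..v} (\<lambda>t. norm (R t)) = F v"
      unfolding F_def using uv x0
      by (intro Henstock_Kurzweil_Integration.integral_combine R_integrable_Icc) auto
    ultimately show "integral {u..v} (\<lambda>t. norm (R t)) \<le> \<epsilon>" using x0(2) by linarith
  qed
qed

text \<open>\<open>T\<close> is kept next to \<open>\<Psi> t\<close> because the Bohl bounds hold
  for products such as \<open>\<Phi> x ** P ** \<Psi> t\<close>, not for \<open>\<Psi> t\<close>
  alone. The choice \<open>T = mat 1\<close> serves uniqueness.\<close>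

lemma sol_increment_bound:
  fixes T :: "complex^'n^'n"
  assumes W: "sol W" and uv: "0 \<le> u" "u \<le> v"
    and bound: "\<And>t. t \<in> {u..v} \<Longrightarrow> norm (T ** \<Psi> t) * norm (W t) \<le> L"
  shows "norm (T ** (\<Psi> v ** W v - \<Psi> u ** W u)) \<le> L * integral {u..v} (\<lambda>t. norm (R t))"
proof -
  have int: "((\<lambda>t. T ** (\<Psi> t ** R t ** W t)) has_integral T ** (\<Psi> v ** W v - \<Psi> u ** W u)) {u..v}"
    using has_integral_linear[OF sol_has_integral[OF W uv] mm.bounded_linear_right[of T]]
    by (simp add: o_def)
  have "norm (integral {u..v} (\<lambda>t. T ** (\<Psi> t ** R t ** W t))) \<le> integral {u..v} (\<lambda>t. L * norm (R t))"
  proof (rule integral_norm_bound_integral)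
    show "(\<lambda>t. L * norm (R t)) integrable_on {u..v}"
      by (rule integrable_on_mult_right[OF R_integrable_Icc[OF uv(1)]])
    fix t assume t: "t \<in> {u..v}"
    have "norm (T ** (\<Psi> t ** R t ** W t)) = norm ((T ** \<Psi> t) ** R t ** W t)"
      by (simp add: matrix_mul_assoc)
    also have "\<dots> \<le> norm (T ** \<Psi> t) * norm (R t) * norm (W t)"
      by (intro order_trans[OF norm_matrix_matrix_mult_le] mult_right_mono norm_matrix_matrix_mult_le norm_ge_zero)
    also have "\<dots> = norm (T ** \<Psi> t) * norm (W t) * norm (R t)" by simp
    also have "\<dots> \<le> L * norm (R t)"
      using bound[OF t] by (rule mult_right_mono) simp
    finally show "norm (T ** (\<Psi> t ** R t ** W t)) \<le> L * norm (R t)" .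
  qed (use int in blast)
  then show ?thesis using integral_unique[OF int] by simp
qed

text \<open>The zero is propagated for \<open>\<Psi> t ** W t\<close>, whose increments are
  integrals against \<open>R\<close>; multiplication by \<open>\<Phi> t\<close> returns to
  \<open>W\<close>.\<close>

lemma sol_unique:
  assumes W: "sol W" and c: "c \<ge> 0" "W c = 0" and x: "x \<ge> 0"
  shows "W x = 0"
proof -
  define b where "b = max c x"
  have contW: "continuous_on {0..b} W" using sol_continuous_on[OF W] .
  have cont\<Psi>: "continuous_on {0..b} (\<lambda>x. \<Psi> x)"
    using inv by (intro continuous_on_matrix_inv cont) auto
  obtain B where B: "B > 0" "\<And>x. x \<in> {0..b} \<Longrightarrow> norm (\<Phi> x) \<le> B"
    using continuous_on_Icc_bounded[OF cont] by blast
  obtain C where C: "C > 0" "\<And>x. x \<in> {0..b} \<Longrightarrow> norm (\<Psi> x) \<le> C"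
    using continuous_on_Icc_bounded[OF cont\<Psi>] by blast
  have WV: "W t = \<Phi> t ** (\<Psi> t ** W t)" if "t \<ge> 0" for t
    using matrix_inv(1)[OF inv[OF that]] by (simp add: matrix_mul_assoc)
  have "\<Psi> x ** W x = 0"
  proof (rule continuous_zero_propagation[of 0 b "\<lambda>t. \<Psi> t ** W t" "\<lambda>t. C * B * norm (R t)" c])
    show "continuous_on {0..b} (\<lambda>t. \<Psi> t ** W t)"
      by (rule mm.continuous_on[OF cont\<Psi> contW])
    show "(\<lambda>t. C * B * norm (R t)) integrable_on {0..b}"
      by (rule integrable_on_mult_right[OF R_integrable_Icc]) simp
    fix u v M assume uv: "0 \<le> u" "u \<le> v" "v \<le> b"
      and M: "\<And>t. t \<in> {u..v} \<Longrightarrow> norm (\<Psi> t ** W t) \<le> M"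
    have "norm (mat 1 ** (\<Psi> v ** W v - \<Psi> u ** W u)) \<le> C * B * M * integral {u..v} (\<lambda>t. norm (R t))"
    proof (rule sol_increment_bound[OF W uv(1,2)])
      fix t assume t: "t \<in> {u..v}"
      then have t0: "t \<in> {0..b}" using uv by auto
      have "norm (W t) \<le> norm (\<Phi> t) * norm (\<Psi> t ** W t)"
        using WV[of t] t0 norm_matrix_matrix_mult_le[of "\<Phi> t" "\<Psi> t ** W t"] by simp
      also have "\<dots> \<le> B * M"
        using B(2)[OF t0] M[OF t] B(1) by (intro mult_mono) auto
      finally have "norm (W t) \<le> B * M" .
      then have "norm (\<Psi> t) * norm (W t) \<le> C * (B * M)"
        using C(2)[OF t0] C(1) by (intro mult_mono) auto
      then show "norm (mat 1 ** \<Psi> t) * norm (W t) \<le> C * B * M" by simp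
    qed
    then show "norm (\<Psi> v ** W v - \<Psi> u ** W u) \<le> M * integral {u..v} (\<lambda>t. C * B * norm (R t))"
      by (simp add: ac_simps)
  qed (use c x in \<open>auto simp: b_def\<close>)
  with WV[OF x] show ?thesis by simp
qed

text \<open>Before the point where the eventual bound starts, continuity on a compact interval
  bounds \<open>exp (- \<mu> * x) *\<^sub>R W x\<close>.\<close>

lemma sol_exp_bound:
  assumes W: "sol W" and ord: "exp_order \<mu> W"
  obtains M where "\<And>x. x \<ge> 0 \<Longrightarrow> norm (W x) \<le> M * exp (\<mu> * x)"
proof -
  obtain C where "\<forall>\<^sub>F x in at_top. norm (W x) \<le> C * exp (\<mu> * x)"
    using ord unfolding exp_order_def by blast
  then obtain b where b: "\<And>x. x \<ge> b \<Longrightarrow> norm (W x) \<le> C * exp (\<mu> * x)"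
    unfolding eventually_at_top_linorder by blast
  have "continuous_on {0..b} (\<lambda>x. exp (- \<mu> * x) *\<^sub>R W x)"
    by (intro continuous_intros sol_continuous_on W)
  then obtain B where B: "B > 0" "\<And>x. x \<in> {0..b} \<Longrightarrow> norm (exp (- \<mu> * x) *\<^sub>R W x) \<le> B"
    using continuous_on_Icc_bounded by blast
  show thesis
  proof (rule that)
    fix x :: real assume "x \<ge> 0"
    show "norm (W x) \<le> max B C * exp (\<mu> * x)"
    proof (cases "x \<ge> b")
      case True
      have "C * exp (\<mu> * x) \<le> max B C * exp (\<mu> * x)" by (intro mult_right_mono) auto
      then show ?thesis using b[OF True] by linarith
    next
      case False
      then have "exp (- \<mu> * x) * norm (W x) \<le> B" using B(2)[of x] \<open>x \<ge> 0\<close> by simp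
      then have "norm (W x) \<le> B * exp (\<mu> * x)" by (simp add: exp_minus field_simps)
      moreover have "B * exp (\<mu> * x) \<le> max B C * exp (\<mu> * x)" by (intro mult_right_mono) auto
      ultimately show ?thesis by linarith
    qed
  qed
qed

text \<open>The kernel bounds contain \<open>C\<close>, so the tail bound \<open>1 / (4 * C)\<close>
  makes each projected part at most a quarter of the current bound, and together they halve it.
  Equality of \<alpha> and \<mu> is harmless because the boundary term at \<open>x\<^sub>0\<close>
  is zero by assumption; \<mu> < \<beta> is strict because the one at infinity has to decay.\<close>

lemma sol_zero_of_projected_zero:
  assumes est1: "\<And>x x'. 0 \<le> x' \<Longrightarrow> x' \<le> x \<Longrightarrow> norm (\<Phi> x ** P ** \<Psi> x') \<le> C * exp (\<alpha> * (x - x'))"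
    and est2: "\<And>x x'. 0 \<le> x \<Longrightarrow> x \<le> x' \<Longrightarrow> norm (\<Phi> x ** (mat 1 - P) ** \<Psi> x') \<le> C * exp (\<beta> * (x - x'))"
    and "C > 0" and \<mu>: "\<alpha> \<le> \<mu>" "\<mu> < \<beta>"
    and x0: "x\<^sub>0 \<ge> 0" "\<And>u v. x\<^sub>0 \<le> u \<Longrightarrow> u \<le> v \<Longrightarrow> integral {u..v} (\<lambda>t. norm (R t)) \<le> 1 / (4 * C)"
    and D: "sol D" "exp_order \<mu> D" and zero: "P ** (\<Psi> x\<^sub>0 ** D x\<^sub>0) = 0" and "x \<ge> 0"
  shows "D x = 0"
proof -
  obtain M where M: "\<And>x. x \<ge> 0 \<Longrightarrow> norm (D x) \<le> M * exp (\<mu> * x)"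
    using sol_exp_bound[OF D] by blast
  have "D x\<^sub>0 = 0"
  proof (rule halving_bounds_imp_zero[of "{x\<^sub>0..}" D "\<lambda>x. exp (\<mu> * x)" M])
    fix M x assume M: "\<And>x. x \<in> {x\<^sub>0..} \<Longrightarrow> norm (D x) \<le> M * exp (\<mu> * x)" and x: "x \<in> {x\<^sub>0..}"
    have "M * exp (\<mu> * x) \<ge> 0" using M[OF x] norm_ge_zero order_trans by blast
    then have "M \<ge> 0" by (simp add: zero_le_mult_iff)
    have L: "C * M * exp (\<mu> * x) \<ge> 0" using \<open>C > 0\<close> \<open>M \<ge> 0\<close> by simp
    have quarter: "C * M * exp (\<mu> * x) * integral {u..v} (\<lambda>t. norm (R t)) \<le> M / 4 * exp (\<mu> * x)"
      if "x\<^sub>0 \<le> u" "u \<le> v" for u v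
      using mult_left_mono[OF x0(2)[OF that] L] \<open>C > 0\<close> by (simp add: field_simps)
    \<comment> \<open>Used with \<alpha> for \<open>t\<close> up to \<open>x\<close> and with
      \<beta> for \<open>t\<close> from \<open>x\<close> on; in both cases the sign condition lets
      the factor \<open>exp ((\<gamma> - \<mu>) * (x - t))\<close> be dropped.\<close>
    have kernel: "norm (T ** \<Psi> t) * norm (D t) \<le> C * M * exp (\<mu> * x)"
      if "norm (T ** \<Psi> t) \<le> C * exp (\<gamma> * (x - t))" "t \<ge> x\<^sub>0" "(\<gamma> - \<mu>) * (x - t) \<le> 0" for T :: "complex^'n^'n" and t \<gamma>
    proof -
      have "norm (T ** \<Psi> t) * norm (D t) \<le> C * exp (\<gamma> * (x - t)) * (M * exp (\<mu> * t))"
        using that M[of t] \<open>C > 0\<close> by (intro mult_mono) auto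
      also have "\<dots> = C * M * exp ((\<gamma> - \<mu>) * (x - t) + \<mu> * x)"
        by (simp add: algebra_simps flip: exp_add)
      also have "\<dots> \<le> C * M * exp (\<mu> * x)"
        using that(3) \<open>C > 0\<close> \<open>M \<ge> 0\<close> by (intro mult_left_mono) auto
      finally show ?thesis .
    qed
    have 1: "norm (\<Phi> x ** P ** (\<Psi> x ** D x)) \<le> M / 4 * exp (\<mu> * x)"
    proof -
      have "norm (\<Phi> x ** P ** (\<Psi> x ** D x - \<Psi> x\<^sub>0 ** D x\<^sub>0)) \<le> C * M * exp (\<mu> * x) * integral {x\<^sub>0..x} (\<lambda>t. norm (R t))"
        using x x0(1) \<mu>
        by (intro sol_increment_bound[OF D(1)] kernel[of _ _ \<alpha>] est1)
          (auto simp: mult_nonpos_nonneg)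
      moreover have "\<Phi> x ** P ** (\<Psi> x ** D x - \<Psi> x\<^sub>0 ** D x\<^sub>0) = \<Phi> x ** P ** (\<Psi> x ** D x)"
        using zero by (simp add: mm.diff_right matrix_mul_assoc[symmetric])
      ultimately show ?thesis using quarter[of x\<^sub>0 x] x by simp
    qed
    have 2: "norm (\<Phi> x ** (mat 1 - P) ** (\<Psi> x ** D x)) \<le> M / 4 * exp (\<mu> * x)"
    proof -
      let ?T = "\<Phi> x ** (mat 1 - P)"
      \<comment> \<open>A finite \<open>y\<close> replaces infinity as the starting point of the
        integration; the last summand is the boundary term left at \<open>y\<close>, which vanishes
        in the limit.\<close>
      have le: "norm (?T ** (\<Psi> x ** D x)) \<le> M / 4 * exp (\<mu> * x) + C * M * exp (\<beta> * x) * exp ((\<mu> - \<beta>) * y)" if "y \<ge> x" for y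
      proof -
        have "norm (?T ** (\<Psi> y ** D y - \<Psi> x ** D x)) \<le> C * M * exp (\<mu> * x) * integral {x..y} (\<lambda>t. norm (R t))"
          using x x0(1) \<mu> that
          by (intro sol_increment_bound[OF D(1)] kernel[of _ _ \<beta>] est2)
            (auto simp: mult_nonneg_nonpos)
        also have "\<dots> \<le> M / 4 * exp (\<mu> * x)" using quarter[of x y] x that by simp
        finally have a: "norm (?T ** (\<Psi> y ** D y - \<Psi> x ** D x)) \<le> M / 4 * exp (\<mu> * x)" .
        have "norm (?T ** (\<Psi> y ** D y)) \<le> norm (?T ** \<Psi> y) * norm (D y)"
          using norm_matrix_matrix_mult_le[of "?T ** \<Psi> y" "D y"] by (simp add: matrix_mul_assoc)
        also have "\<dots> \<le> C * exp (\<beta> * (x - y)) * (M * exp (\<mu> * y))"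
          using est2[of x y] M[of y] x x0(1) that \<open>C > 0\<close> by (intro mult_mono) auto
        also have "\<dots> = C * M * exp (\<beta> * x) * exp ((\<mu> - \<beta>) * y)"
          by (simp add: algebra_simps flip: exp_add)
        finally have b: "norm (?T ** (\<Psi> y ** D y)) \<le> C * M * exp (\<beta> * x) * exp ((\<mu> - \<beta>) * y)" .
        have "?T ** (\<Psi> x ** D x) = ?T ** (\<Psi> y ** D y) - ?T ** (\<Psi> y ** D y - \<Psi> x ** D x)"
          by (simp add: mm.diff_right)
        then show ?thesis
          using a b norm_triangle_ineq4[of "?T ** (\<Psi> y ** D y)" "?T ** (\<Psi> y ** D y - \<Psi> x ** D x)"]
          by simp
      qed
      have "((\<lambda>y. exp ((\<mu> - \<beta>) * y)) \<longlongrightarrow> 0) at_top"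
        using \<mu>(2) by (intro filterlim_compose[OF exp_at_bot] filterlim_tendsto_neg_mult_at_bot[of _ "\<mu> - \<beta>"])
          (auto intro: filterlim_ident)
      then have "((\<lambda>y. M / 4 * exp (\<mu> * x) + C * M * exp (\<beta> * x) * exp ((\<mu> - \<beta>) * y))
          \<longlongrightarrow> M / 4 * exp (\<mu> * x) + C * M * exp (\<beta> * x) * 0) at_top"
        by (intro tendsto_intros)
      then have "norm (?T ** (\<Psi> x ** D x)) \<le> M / 4 * exp (\<mu> * x) + C * M * exp (\<beta> * x) * 0"
        by (rule tendsto_lowerbound) (use le in \<open>auto intro!: eventually_at_top_linorderI[of x]\<close>)
      then show ?thesis by simp
    qed
    have "D x = \<Phi> x ** P ** (\<Psi> x ** D x) + \<Phi> x ** (mat 1 - P) ** (\<Psi> x ** D x)"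
    proof -
      have "\<Phi> x ** P ** (\<Psi> x ** D x) + \<Phi> x ** (mat 1 - P) ** (\<Psi> x ** D x) = \<Phi> x ** \<Psi> x ** D x"
        by (simp add: mm.diff_left mm.diff_right matrix_mul_assoc)
      also have "\<dots> = D x" using matrix_inv(1)[OF inv] x x0(1) by simp
      finally show ?thesis by simp
    qed
    then show "norm (D x) \<le> M / 2 * exp (\<mu> * x)"
      using 1 2 norm_triangle_ineq[of "\<Phi> x ** P ** (\<Psi> x ** D x)" "\<Phi> x ** (mat 1 - P) ** (\<Psi> x ** D x)"]
      by simp
  qed (use M x0 in auto)
  then show ?thesis
    using sol_unique[OF D(1) x0(1) _ \<open>x \<ge> 0\<close>] by blast
qed

text \<open>
  The matrix \<open>G\<close> in the proof maps \<open>M\<close> to \<open>P \<Psi>(x\<^sub>0) Y(x\<^sub>0) M\<close> on the range of \<open>P\<close> and is the identity on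
  its complement; invertibility of \<open>G\<close> replaces a dimension count.
\<close>

lemma sol_representation:
  assumes est1: "\<And>x x'. 0 \<le> x' \<Longrightarrow> x' \<le> x \<Longrightarrow> norm (\<Phi> x ** P ** \<Psi> x') \<le> C * exp (\<alpha> * (x - x'))"
    and est2: "\<And>x x'. 0 \<le> x \<Longrightarrow> x \<le> x' \<Longrightarrow> norm (\<Phi> x ** (mat 1 - P) ** \<Psi> x') \<le> C * exp (\<beta> * (x - x'))"
    and "C > 0" and \<mu>: "\<alpha> \<le> \<mu>" "\<mu> < \<beta>" and P: "P ** P = P"
    and Y: "sol Y" "exp_order \<mu> Y" and W: "sol W" "exp_order \<mu> W"
    and nondeg: "\<And>M :: complex^'n^'n. P ** M = M \<Longrightarrow> (\<And>x. x \<ge> 0 \<Longrightarrow> Y x ** M = 0) \<Longrightarrow> M = 0"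
  obtains M :: "complex^'n^'n" where "P ** M = M" "\<And>x. x \<ge> 0 \<Longrightarrow> W x = Y x ** M"
proof -
  obtain x\<^sub>0 where x0: "x\<^sub>0 \<ge> 0" "\<And>u v. x\<^sub>0 \<le> u \<Longrightarrow> u \<le> v \<Longrightarrow> integral {u..v} (\<lambda>t. norm (R t)) \<le> 1 / (4 * C)"
    using integral_R_tail[of "1 / (4 * C)"] \<open>C > 0\<close> by auto
  have vanish: "D x = 0" if "sol D" "exp_order \<mu> D" "P ** (\<Psi> x\<^sub>0 ** D x\<^sub>0) = 0" "x \<ge> 0" for D x
    by (rule sol_zero_of_projected_zero[where P = P and C = C and \<alpha> = \<alpha> and \<beta> = \<beta> and \<mu> = \<mu> and x\<^sub>0 = x\<^sub>0])
      (fact est1 est2 \<open>C > 0\<close> \<mu> x0 that)+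
  define K where "K = P ** \<Psi> x\<^sub>0 ** Y x\<^sub>0"
  define G where "G = K ** P + (mat 1 - P)"
  have PK: "P ** K = K" by (simp add: K_def matrix_mul_assoc P)
  have PG: "P ** G = K ** P"
    by (simp add: G_def mm.add_right mm.diff_right matrix_mul_assoc PK P)
  have QG: "G - P ** G = mat 1 - P"
    unfolding PG by (simp add: G_def)
  \<comment> \<open>Modulo the range of \<open>P\<close>, \<open>G\<close> acts as the identity, so
    \<open>G ** M\<close> in that range forces \<open>M\<close> into it. This serves both the kernel
    (right side 0) and the solution \<open>M\<close> below.\<close>
  have split: "P ** M = M \<and> K ** M = P ** (G ** M)" if "P ** (G ** M) = G ** M" for M :: "complex^'n^'n"
  proof -
    have "(G - P ** G) ** M = 0" using that by (simp add: mm.diff_left matrix_mul_assoc[symmetric])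
    then have PM: "P ** M = M" unfolding QG by (simp add: mm.diff_left)
    have "P ** (G ** M) = K ** (P ** M)" by (simp add: matrix_mul_assoc PG)
    with PM show ?thesis by simp
  qed
  have ker: "M = 0" if GM: "G ** M = 0" for M :: "complex^'n^'n"
  proof (rule nondeg)
    show "P ** M = M" using split[of M] GM by simp
    have KM: "K ** M = 0" using split[of M] GM by simp
    show "Y x ** M = 0" if "x \<ge> 0" for x
    proof (rule vanish[OF _ _ _ that])
      show "P ** (\<Psi> x\<^sub>0 ** (Y x\<^sub>0 ** M)) = 0" using KM by (simp add: K_def matrix_mul_assoc)
    qed (intro sol_mult_right exp_order_matrix_mult_right Y)+
  qed
  then have G: "invertible G" by (rule invertible_if_trivial_kernel)
  define M where "M = matrix_inv G ** (P ** \<Psi> x\<^sub>0 ** W x\<^sub>0)"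
  have GM: "G ** M = P ** \<Psi> x\<^sub>0 ** W x\<^sub>0"
    using matrix_inv(1)[OF G] by (simp add: M_def matrix_mul_assoc)
  then have "P ** (G ** M) = G ** M" by (simp add: matrix_mul_assoc P)
  then have PM: "P ** M = M" and KM: "K ** M = P ** \<Psi> x\<^sub>0 ** W x\<^sub>0" using split[of M] GM by auto
  show thesis
  proof (rule that[OF PM])
    fix x :: real assume x: "x \<ge> 0"
    have "W x - Y x ** M = 0"
    proof (rule vanish[OF _ _ _ x])
      show "sol (\<lambda>x. W x - Y x ** M)" by (intro sol_diff W sol_mult_right Y)
      show "exp_order \<mu> (\<lambda>x. W x - Y x ** M)" by (intro exp_order_diff W exp_order_matrix_mult_right Y)
      show "P ** (\<Psi> x\<^sub>0 ** (W x\<^sub>0 - Y x\<^sub>0 ** M)) = 0"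
        using KM by (simp add: K_def mm.diff_right matrix_mul_assoc)
    qed
    then show "W x = Y x ** M" by simp
  qed
qed

end

section \<open>Block unipotent matrices\<close>

text \<open>
  Conjugation by \<open>mat 1 + P\<close> turns \<open>mat 1 + E\<close> into \<open>mat 1 + 2E = (mat 1 + E)\<^sup>2\<close>, so the determinant
  equals its own square.
\<close>

lemma det_elementary:
  fixes E P :: "complex^'n^'n"
  assumes PP: "P ** P = P" and PE: "P ** E = E" and EP: "E ** P = 0"
  shows "det (mat 1 + E) = 1"
proof -
  have EE: "E ** E = 0" by (metis EP PE matrix_mul_assoc mm.zero_left)
  define D where "D = mat 1 + P"
  \<comment> \<open>The inverse of \<open>mat 1 + P\<close> for an idempotent \<open>P\<close>; it
    shows that \<open>det D\<close> can be cancelled.\<close>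
  define D' where "D' = mat 1 - (1/2) *\<^sub>R P"
  have "D ** D' = mat 1 + (P - (1/2) *\<^sub>R P - (1/2) *\<^sub>R P)"
    by (simp add: D_def D'_def mm.add_left mm.add_right mm.diff_left mm.diff_right mm.scaleR_right PP)
  also have "P - (1/2) *\<^sub>R P - (1/2) *\<^sub>R P = 0"
    by (simp flip: scaleR_left_distrib add: diff_diff_eq)
  finally have "D ** D' = mat 1" by simp
  then have "det D * det D' = 1" by (metis det_I det_mul)
  then have "det D \<noteq> 0" by auto
  have "(mat 1 + E) ** (mat 1 - E) = mat 1"
    by (simp add: mm.add_left mm.add_right mm.diff_left mm.diff_right EE)
  then have "det (mat 1 + E) * det (mat 1 - E) = 1" by (metis det_I det_mul)
  then have nz: "det (mat 1 + E) \<noteq> 0" by auto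
  have "D ** (mat 1 + E) = mat 1 + P + (E + E)"
    by (simp only: D_def mm.add_left mm.add_right matrix_mul_lid matrix_mul_rid PE ac_simps)
  moreover have "(mat 1 + E) ** (mat 1 + E) ** D = mat 1 + P + (E + E)"
    by (simp only: D_def mm.add_left mm.add_right matrix_mul_lid matrix_mul_rid EP EE add_0_left add_0_right ac_simps)
  ultimately have "D ** (mat 1 + E) = (mat 1 + E) ** (mat 1 + E) ** D" by simp
  then have "det D * det (mat 1 + E) = det (mat 1 + E) * det (mat 1 + E) * det D"
    by (metis det_mul)
  with nz \<open>det D \<noteq> 0\<close> show ?thesis by simp
qed

text \<open>One rule for all partial sums: equal index sets give idempotence, nested ones
  absorption, disjoint ones annihilation.\<close>

lemma sum_orthogonal_idempotents_mult:
  fixes Q :: "nat \<Rightarrow> complex^'n^'n"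
  assumes orth: "\<And>i j. i \<in> I \<Longrightarrow> j \<in> I \<Longrightarrow> Q i ** Q j = (if i = j then Q i else 0)"
    and "finite I" and sub: "A \<subseteq> I" "B \<subseteq> I"
  shows "sum Q A ** sum Q B = sum Q (A \<inter> B)"
proof -
  have "finite A" "finite B" using \<open>finite I\<close> sub finite_subset by blast+
  have "sum Q A ** sum Q B = (\<Sum>i\<in>A. \<Sum>j\<in>B. Q i ** Q j)"
    by (simp only: mm.sum_left mm.sum_right) (rule sum.swap)
  also have "\<dots> = (\<Sum>i\<in>A. \<Sum>j\<in>B. if i = j then Q i else 0)"
    by (intro sum.cong refl orth) (use sub in auto)
  also have "\<dots> = (\<Sum>i\<in>A. if i \<in> B then Q i else 0)"
    using \<open>finite B\<close> by (simp add: sum.delta)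
  also have "\<dots> = sum Q (A \<inter> B)"
    using \<open>finite A\<close> by (simp add: sum.inter_restrict)
  finally show ?thesis .
qed

text \<open>\<open>M j\<close> sees only the range of \<open>Q j\<close> and maps it into the ranges
  of lower index, so the sum is strictly block triangular; in particular \<open>M 1 = 0\<close>. The
  determinant is found by splitting off one block column at a time.\<close>

lemma det_unipotent:
  fixes Q M :: "nat \<Rightarrow> complex^'n^'n"
  assumes orth: "\<And>i j. i \<in> {1..k} \<Longrightarrow> j \<in> {1..k} \<Longrightarrow> Q i ** Q j = (if i = j then Q i else 0)"
    and M: "\<And>j. j \<in> {1..k} \<Longrightarrow> sum Q {1..<j} ** M j = M j"
      "\<And>j. j \<in> {1..k} \<Longrightarrow> M j ** Q j = M j"
  shows "det (mat 1 + (\<Sum>j=1..k. M j)) = 1"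
  using assms
proof (induction k)
  case 0
  then show ?case by simp
next
  case (Suc k)
  let ?S = "\<Sum>j=1..k. M j" and ?P = "sum Q {1..<Suc k}"
  note orth = Suc.prems(1) and M = Suc.prems(2,3)
  have QP: "Q (Suc k) ** sum Q {1..<j} = 0" if "j \<le> Suc k" for j
    using sum_orthogonal_idempotents_mult[of "{1..Suc k}" Q "{Suc k}" "{1..<j}"] orth that by (auto simp: subset_eq)
  have "M (Suc k) ** M l = 0" if "l \<in> {1..k}" for l
  proof -
    have "M (Suc k) ** M l = (M (Suc k) ** Q (Suc k)) ** (sum Q {1..<l} ** M l)"
      using M[of "Suc k"] M[of l] that by simp
    also have "\<dots> = M (Suc k) ** (Q (Suc k) ** sum Q {1..<l}) ** M l"
      by (simp add: matrix_mul_assoc)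
    finally show ?thesis using QP[of l] that by simp
  qed
  then have "M (Suc k) ** ?S = 0" by (simp add: mm.sum_right)
  \<comment> \<open>The factor with \<open>M (Suc k)\<close> stands on the left because
    \<open>M (Suc k) ** ?S\<close> vanishes; the opposite order would leave a cross term.\<close>
  then have "mat 1 + (\<Sum>j=1..Suc k. M j) = (mat 1 + M (Suc k)) ** (mat 1 + ?S)"
    by (simp add: mm.add_left mm.add_right ac_simps)
  moreover have "det (mat 1 + M (Suc k)) = 1"
  proof (rule det_elementary)
    show "?P ** ?P = ?P"
      using sum_orthogonal_idempotents_mult[of "{1..Suc k}" Q "{1..<Suc k}" "{1..<Suc k}"] orth
      by (metis Int_absorb atLeastLessThanSuc_atLeastAtMost atLeastatMost_subset_iff finite_atLeastAtMost le_SucI order_refl)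
    show "?P ** M (Suc k) = M (Suc k)" using M(1)[of "Suc k"] by simp
    show "M (Suc k) ** ?P = 0"
      by (metis M(2)[of "Suc k"] QP[of "Suc k"] atLeastAtMost_iff le_add1 matrix_mul_assoc mm.zero_right
          order_refl plus_1_eq_Suc)
  qed
  moreover have "det (mat 1 + ?S) = 1"
    using orth M by (intro Suc.IH) auto
  ultimately show ?case by (simp add: det_mul)
qed

section \<open>Jost solutions on a half-line\<close>

text \<open>Some admissible rate lies below \<open>\<alpha>\<close>, and rates may be raised since
  \<open>x - x'\<close> is nonnegative. The absolute value of \<open>C\<close> saves a sign
  discussion. The lower exponent is dual: there \<open>x - x'\<close> is nonpositive and rates may
  be lowered.\<close>

lemma upper_bohl_less_imp_bound:
  assumes "upper_bohl \<Phi> J P < ereal \<alpha>"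
  shows "\<exists>C. \<forall>x\<in>J. \<forall>x'\<in>J. x \<ge> x' \<longrightarrow> norm (\<Phi> x ** P ** matrix_inv (\<Phi> x')) \<le> C * exp (\<alpha> * (x - x'))"
proof -
  obtain \<kappa> C where "\<kappa> < \<alpha>"
    and C: "\<And>x x'. x \<in> J \<Longrightarrow> x' \<in> J \<Longrightarrow> x \<ge> x' \<Longrightarrow> norm (\<Phi> x ** P ** matrix_inv (\<Phi> x')) \<le> C * exp (\<kappa> * (x - x'))"
    using assms unfolding upper_bohl_def Inf_less_iff by auto
  show ?thesis
  proof (intro exI[of _ "\<bar>C\<bar>"] ballI impI)
    fix x x' assume "x \<in> J" "x' \<in> J" "x \<ge> x'"
    then have "norm (\<Phi> x ** P ** matrix_inv (\<Phi> x')) \<le> C * exp (\<kappa> * (x - x'))" by (rule C)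
    also have "\<dots> \<le> \<bar>C\<bar> * exp (\<alpha> * (x - x'))"
      using \<open>\<kappa> < \<alpha>\<close> \<open>x \<ge> x'\<close> by (intro mult_mono) (auto intro!: mult_right_mono)
    finally show "norm (\<Phi> x ** P ** matrix_inv (\<Phi> x')) \<le> \<bar>C\<bar> * exp (\<alpha> * (x - x'))" .
  qed
qed

lemma less_lower_bohl_imp_bound:
  assumes "ereal \<beta> < lower_bohl \<Phi> J P"
  shows "\<exists>C. \<forall>x\<in>J. \<forall>x'\<in>J. x \<le> x' \<longrightarrow> norm (\<Phi> x ** P ** matrix_inv (\<Phi> x')) \<le> C * exp (\<beta> * (x - x'))"
proof -
  obtain \<kappa> C where "\<beta> < \<kappa>"
    and C: "\<And>x x'. x \<in> J \<Longrightarrow> x' \<in> J \<Longrightarrow> x \<le> x' \<Longrightarrow> norm (\<Phi> x ** P ** matrix_inv (\<Phi> x')) \<le> C * exp (\<kappa> * (x - x'))"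
    using assms unfolding lower_bohl_def less_Sup_iff by auto
  show ?thesis
  proof (intro exI[of _ "\<bar>C\<bar>"] ballI impI)
    fix x x' assume "x \<in> J" "x' \<in> J" "x \<le> x'"
    then have "norm (\<Phi> x ** P ** matrix_inv (\<Phi> x')) \<le> C * exp (\<kappa> * (x - x'))" by (rule C)
    also have "\<dots> \<le> \<bar>C\<bar> * exp (\<beta> * (x - x'))"
      using \<open>\<beta> < \<kappa>\<close> \<open>x \<le> x'\<close> by (intro mult_mono) (auto intro!: mult_right_mono_neg)
    finally show "norm (\<Phi> x ** P ** matrix_inv (\<Phi> x')) \<le> \<bar>C\<bar> * exp (\<beta> * (x - x'))" .
  qed
qed

text \<open>The strict inequality gives an eventual bound with constant 1. At zeros of
  \<open>F\<close>, where the logarithm is minus infinity, that bound is trivial.\<close>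

lemma Limsup_log_less_imp_exp_order:
  assumes "Limsup at_top (\<lambda>x. ereal (1 / x) * log_ereal (norm (F x))) < ereal \<nu>"
  shows "exp_order \<nu> F"
proof -
  have "\<forall>\<^sub>F x in at_top. ereal (1 / x) * log_ereal (norm (F x)) < ereal \<nu>"
    by (rule Limsup_lessD[OF assms])
  then have "\<forall>\<^sub>F x in at_top. norm (F x) \<le> 1 * exp (\<nu> * x)"
    using eventually_gt_at_top[of 0]
  proof eventually_elim
    case (elim x)
    show ?case
    proof (cases "F x = 0")
      case False
      then have "ln (norm (F x)) / x < \<nu>" using elim by (simp add: log_ereal_def)
      then have "ln (norm (F x)) < \<nu> * x" using elim by (simp add: field_simps)
      then have "norm (F x) < exp (\<nu> * x)" using False by (metis exp_less_cancel_iff exp_ln zero_less_norm_iff)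
      then show ?thesis by simp
    qed simp
  qed
  then show ?thesis unfolding exp_order_def by blast
qed

text \<open>In its uses \<open>p\<close> is a pair of points and \<open>X\<close> encodes their
  order, so that the Bohl bounds of several projections add up to one for their sum.\<close>

lemma ex_bound_sum:
  fixes F :: "'i \<Rightarrow> 'p \<Rightarrow> 'a::real_normed_vector"
  assumes "\<And>i. i \<in> I \<Longrightarrow> \<exists>C. \<forall>p\<in>X. norm (F i p) \<le> C * w p"
  shows "\<exists>C. \<forall>p\<in>X. norm (\<Sum>i\<in>I. F i p) \<le> C * w p"
proof -
  obtain C where C: "\<And>i p. i \<in> I \<Longrightarrow> p \<in> X \<Longrightarrow> norm (F i p) \<le> C i * w p"
    using assms by metis
  have "norm (\<Sum>i\<in>I. F i p) \<le> (\<Sum>i\<in>I. C i) * w p" if "p \<in> X" for p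
    unfolding sum_distrib_right by (rule sum_norm_le) (use C that in auto)
  then show ?thesis by blast
qed

text \<open>Finitely many strict inequalities between extended reals are separated by one real rate,
  even if the exponents are infinite.\<close>

lemma ereal_gap:
  fixes L :: ereal
  assumes "finite S" "S \<noteq> {}" "\<And>s. s \<in> S \<Longrightarrow> s < L"
  obtains r where "\<And>s. s \<in> S \<Longrightarrow> s < ereal r" "ereal r < L"
proof -
  have "Max S < L" using assms by simp
  then obtain r where "Max S < ereal r" "ereal r < L" using ereal_dense2 by blast
  then show thesis using that assms by (metis Max_ge le_less_trans)
qed

context half_line
begin

text \<open>This is \<open>jost_plus\<close> with the differential equation replaced by
  \<open>sol\<close>, so that reflected solutions from the other half-line satisfy the same
  predicate.\<close>

definition jost :: "complex^'n^'n \<Rightarrow> (real \<Rightarrow> complex^'n^'n) \<Rightarrow> bool" where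
  "jost P Y \<longleftrightarrow> sol Y \<and>
    Limsup at_top (\<lambda>x. ereal (1 / x) * log_ereal (norm (Y x - \<Phi> x ** P))) < lower_bohl \<Phi> {0..} P \<and>
    Y 0 = Y 0 ** P"

lemma jost_mult_right:
  assumes "jost P Y" "x \<ge> 0"
  shows "Y x ** P = Y x"
proof -
  have "sol Y" "Y 0 = Y 0 ** P" using assms by (auto simp: jost_def)
  have "Y x ** P - Y x = 0"
    by (rule sol_unique[of _ 0]) (use \<open>sol Y\<close> \<open>Y 0 = Y 0 ** P\<close> assms in \<open>auto intro: sol_diff sol_mult_right\<close>)
  then show ?thesis by simp
qed

lemma exp_order_upper_bohl:
  assumes "upper_bohl \<Phi> {0..} P < ereal \<alpha>"
  shows "exp_order \<alpha> (\<lambda>x. \<Phi> x ** P)"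
proof -
  obtain C where C: "\<forall>x\<in>{0..}. \<forall>x'\<in>{0..}. x \<ge> x' \<longrightarrow> norm (\<Phi> x ** P ** \<Psi> x') \<le> C * exp (\<alpha> * (x - x'))"
    using upper_bohl_less_imp_bound[OF assms] by blast
  have "\<Psi> 0 = mat 1"
    using matrix_inv(1)[OF inv, of 0] by (simp add: start)
  then show ?thesis
    using C[rule_format, of _ 0] by (intro exp_orderI[where C = C]) simp
qed

text \<open>\<open>P ** M\<close> is the product of \<open>P ** \<Psi> x\<close> and
  \<open>\<Phi> x ** P ** M\<close>. The lower exponent makes the first factor decay like
  \<open>exp (- \<beta> * x)\<close>, faster than the second can grow.\<close>

lemma zero_of_exp_order_less_lower_bohl:
  assumes "ereal \<beta> < lower_bohl \<Phi> {0..} P" and P: "P ** P = P" and "\<mu> < \<beta>"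
    and ord: "exp_order \<mu> (\<lambda>x. \<Phi> x ** P ** M)"
  shows "P ** M = 0"
proof -
  obtain C where C: "\<forall>x\<in>{0..}. \<forall>x'\<in>{0..}. x \<le> x' \<longrightarrow> norm (\<Phi> x ** P ** \<Psi> x') \<le> C * exp (\<beta> * (x - x'))"
    using less_lower_bohl_imp_bound[OF assms(1)] by blast
  obtain D where D: "\<forall>\<^sub>F x in at_top. norm (\<Phi> x ** P ** M) \<le> D * exp (\<mu> * x)"
    using ord unfolding exp_order_def by blast
  have "\<forall>\<^sub>F x in at_top. norm (P ** M) \<le> C * D * exp ((\<mu> - \<beta>) * x)"
    using D eventually_ge_at_top[of 0]
  proof eventually_elim
    case (elim x)
    have c: "norm (P ** \<Psi> x) \<le> C * exp (- \<beta> * x)"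
      using C[rule_format, of 0 x] elim by (simp add: start)
    have "(P ** \<Psi> x) ** (\<Phi> x ** P ** M) = P ** (\<Psi> x ** \<Phi> x) ** P ** M"
      by (simp add: matrix_mul_assoc)
    also have "\<dots> = P ** M" using matrix_inv(2)[OF inv] elim P by simp
    finally have "norm (P ** M) \<le> norm (P ** \<Psi> x) * norm (\<Phi> x ** P ** M)"
      using norm_matrix_matrix_mult_le[of "P ** \<Psi> x" "\<Phi> x ** P ** M"] by simp
    also have "\<dots> \<le> C * exp (- \<beta> * x) * (D * exp (\<mu> * x))"
      using c elim(1) order_trans[OF norm_ge_zero c] by (intro mult_mono) auto
    also have "\<dots> = C * D * exp ((\<mu> - \<beta>) * x)"
      by (simp add: algebra_simps flip: exp_add)
    finally show ?case .
  qed
  moreover have "((\<lambda>x. C * D * exp ((\<mu> - \<beta>) * x)) \<longlongrightarrow> C * D * 0) at_top"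
    using \<open>\<mu> < \<beta>\<close> by (intro tendsto_mult tendsto_const filterlim_compose[OF exp_at_bot]
      filterlim_tendsto_neg_mult_at_bot[of _ "\<mu> - \<beta>"]) (auto intro: filterlim_ident)
  ultimately have "norm (P ** M) \<le> C * D * 0"
    by (intro tendsto_lowerbound) auto
  then show ?thesis by simp
qed

end

text \<open>Exponents are those of the half-line, as in the Jost conditions, and increase with the
  index. \<open>segment\<close> together with \<open>separated\<close> makes the lower exponents
  monotone.\<close>

locale half_line_splitting = half_line \<Phi> R
  for \<Phi> R :: "real \<Rightarrow> complex^'n^'n" +
  fixes Q :: "nat \<Rightarrow> complex^'n^'n" and m :: nat
  assumes orth: "\<And>i j. i \<in> {1..m} \<Longrightarrow> j \<in> {1..m} \<Longrightarrow> Q i ** Q j = (if i = j then Q i else 0)"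
    and sum_Q: "(\<Sum>i=1..m. Q i) = mat 1"
    and segment: "\<And>i. i \<in> {1..m} \<Longrightarrow> lower_bohl \<Phi> {0..} (Q i) \<le> upper_bohl \<Phi> {0..} (Q i)"
    and separated: "\<And>i j. 1 \<le> i \<Longrightarrow> i < j \<Longrightarrow> j \<le> m \<Longrightarrow> upper_bohl \<Phi> {0..} (Q i) < lower_bohl \<Phi> {0..} (Q j)"
begin

abbreviation "Plt j \<equiv> sum Q {1..<j}"

lemma P_less_idem: "j \<le> Suc m \<Longrightarrow> Plt j ** Plt j = Plt j"
  using sum_orthogonal_idempotents_mult[of "{1..m}" Q "{1..<j}" "{1..<j}"] orth by (auto simp: subset_eq)

lemma Q_idem: "i \<in> {1..m} \<Longrightarrow> Q i ** Q i = Q i"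
  using orth[of i i] by simp

lemma lower_bohl_mono:
  assumes "1 \<le> i" "i \<le> j" "j \<le> m"
  shows "lower_bohl \<Phi> {0..} (Q i) \<le> lower_bohl \<Phi> {0..} (Q j)"
proof (cases "i = j")
  case False
  have "lower_bohl \<Phi> {0..} (Q i) \<le> upper_bohl \<Phi> {0..} (Q i)" using assms by (intro segment) auto
  also have "\<dots> < lower_bohl \<Phi> {0..} (Q j)" using assms False by (intro separated) auto
  finally show ?thesis by simp
qed simp

text \<open>All rates in play are finitely many: the upper exponents below \<open>j\<close> and the
  error rates of the \<open>Y i\<close> and of \<open>Z\<close>. Each lies strictly below the lower
  exponent of \<open>Q j\<close>, an error of smaller index by monotonicity, so one choice of
  \<alpha>, \<mu>, \<beta> serves them all.\<close>

lemma jost_gap: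
  assumes j: "j \<in> {1..m}" and Y: "\<And>i. i \<in> {1..j} \<Longrightarrow> jost (Q i) (Y i)" and Z: "jost (Q j) Z"
  obtains \<alpha> \<mu> \<beta> where "\<alpha> < \<mu>" "\<mu> < \<beta>"
    "\<And>i. i \<in> {1..<j} \<Longrightarrow> upper_bohl \<Phi> {0..} (Q i) < ereal \<alpha>"
    "\<And>i. i \<in> {j..m} \<Longrightarrow> ereal \<beta> < lower_bohl \<Phi> {0..} (Q i)"
    "\<And>i. i \<in> {1..<j} \<Longrightarrow> exp_order \<mu> (Y i)"
    "exp_order \<mu> (\<lambda>x. Y j x - \<Phi> x ** Q j)" "exp_order \<mu> (\<lambda>x. Z x - \<Phi> x ** Q j)"
proof -
  let ?L = "lower_bohl \<Phi> {0..} (Q j)"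
  define l where "l W i = Limsup at_top (\<lambda>x. ereal (1 / x) * log_ereal (norm (W x - \<Phi> x ** Q i)))" for W i
  define S where "S = insert (l Z j) ((\<lambda>i. l (Y i) i) ` {1..j} \<union> (\<lambda>i. upper_bohl \<Phi> {0..} (Q i)) ` {1..<j})"
  have "s < ?L" if "s \<in> S" for s
  proof -
    have "l (Y i) i < ?L" if "i \<in> {1..j}" for i
    proof -
      have "l (Y i) i < lower_bohl \<Phi> {0..} (Q i)" using Y[OF that] by (simp add: jost_def l_def)
      also have "\<dots> \<le> ?L" using that j by (intro lower_bohl_mono) auto
      finally show ?thesis .
    qed
    moreover have "l Z j < ?L" using Z by (simp add: jost_def l_def)
    moreover have "upper_bohl \<Phi> {0..} (Q i) < ?L" if "i \<in> {1..<j}" for i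
      using that j by (intro separated) auto
    ultimately show ?thesis using that by (auto simp: S_def)
  qed
  then obtain \<alpha> where \<alpha>: "\<And>s. s \<in> S \<Longrightarrow> s < ereal \<alpha>" "ereal \<alpha> < ?L"
    using ereal_gap[of S ?L] by (auto simp: S_def)
  obtain \<beta> where \<beta>: "ereal \<alpha> < ereal \<beta>" "ereal \<beta> < ?L" using ereal_dense2[OF \<alpha>(2)] by blast
  then obtain \<mu> where \<mu>: "\<alpha> < \<mu>" "\<mu> < \<beta>" using dense[of \<alpha> \<beta>] by auto
  have ordl: "exp_order \<mu> (\<lambda>x. W x - \<Phi> x ** Q i)" if "l W i \<in> S" for W i
    using \<alpha>(1)[OF that] \<mu> unfolding l_def by (intro exp_order_mono[OF Limsup_log_less_imp_exp_order]) auto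
  show thesis
  proof (rule that[OF \<mu>])
    show up: "upper_bohl \<Phi> {0..} (Q i) < ereal \<alpha>" if "i \<in> {1..<j}" for i
      using that by (intro \<alpha>(1)) (auto simp: S_def)
    show "ereal \<beta> < lower_bohl \<Phi> {0..} (Q i)" if "i \<in> {j..m}" for i
      using \<beta>(2) lower_bohl_mono[of j i] that j by auto
    show "exp_order \<mu> (Y i)" if "i \<in> {1..<j}" for i
    proof -
      have "exp_order \<mu> (\<lambda>x. (Y i x - \<Phi> x ** Q i) + \<Phi> x ** Q i)"
        using that \<mu> by (intro exp_order_add ordl exp_order_mono[OF exp_order_upper_bohl[OF up]]) (auto simp: S_def)
      then show ?thesis by simp
    qed
  qed (auto intro!: ordl simp: S_def j, use j in auto)
qed

text \<open>
  The highest index \<open>i\<close> with \<open>Q i ** M \<noteq> 0\<close> is excluded by growth: \<open>\<Phi> x ** Q i ** M\<close> would dominate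
  all other terms of the vanishing sum.
\<close>

lemma jost_nondegenerate:
  fixes M :: "complex^'n^'n"
  assumes j: "j \<le> Suc m" and Y: "\<And>i. i \<in> {1..<j} \<Longrightarrow> jost (Q i) (Y i)"
    and PM: "Plt j ** M = M" and zero: "\<And>x. x \<ge> 0 \<Longrightarrow> (\<Sum>i\<in>{1..<j}. Y i x) ** M = 0"
  shows "M = 0"
proof -
  have "Q i ** M = 0" if "i \<in> {1..<j}" for i
    using that
  proof (induction "j - i" arbitrary: i rule: less_induct)
    case less
    then have i: "i \<in> {1..m}" using j by auto
    have above: "Q l ** M = 0" if "l \<in> {i<..<j}" for l
      using that less by (intro less.hyps) auto
    have Yi: "jost (Q l) (Y l)" if "l \<in> {1..i}" for l
      using that less.prems by (intro Y) auto
    obtain \<mu> \<beta> where gap: "\<mu> < \<beta>" "ereal \<beta> < lower_bohl \<Phi> {0..} (Q i)"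
      "\<And>l. l \<in> {1..<i} \<Longrightarrow> exp_order \<mu> (Y l)" "exp_order \<mu> (\<lambda>x. Y i x - \<Phi> x ** Q i)"
    \<comment> \<open>Only one system is present here, so \<open>Y i\<close> also plays the part of
      \<open>Z\<close>.\<close>
    proof (rule jost_gap[OF i Yi, of "Y i"])
      show "jost (Q i) (Y i)" using i by (intro Yi) auto
    qed (use i that in auto)
    have eq: "\<Phi> x ** Q i ** M = - ((Y i x - \<Phi> x ** Q i) ** M) - (\<Sum>l\<in>{1..<i}. Y l x) ** M" if x: "x \<ge> 0" for x
    proof -
      have "Y l x ** M = 0" if l: "l \<in> {i<..<j}" for l
      proof -
        have "Y l x ** M = Y l x ** (Q l ** M)"
          using jost_mult_right[OF Y x, of l] l by (simp add: matrix_mul_assoc)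
        then show ?thesis using above[OF l] by simp
      qed
      then have "(\<Sum>l\<in>{i<..<j}. Y l x) ** M = 0"
        unfolding mm.sum_left by (intro sum.neutral ballI)
      moreover have "{1..<j} = insert i ({1..<i} \<union> {i<..<j})" using less.prems by auto
      then have "(\<Sum>l\<in>{1..<j}. Y l x) = Y i x + ((\<Sum>l\<in>{1..<i}. Y l x) + (\<Sum>l\<in>{i<..<j}. Y l x))"
        by (simp only:) (subst sum.union_disjoint[symmetric], auto)
      ultimately have "Y i x ** M + (\<Sum>l\<in>{1..<i}. Y l x) ** M = 0"
        using zero[OF x] by (simp add: mm.add_left)
      then have "(\<Sum>l\<in>{1..<i}. Y l x) ** M = - (Y i x ** M)"
        by (simp only: add_eq_0_iff)
      then show ?thesis by (simp add: mm.diff_left)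
    qed
    have "exp_order \<mu> (\<lambda>x. - ((Y i x - \<Phi> x ** Q i) ** M) - (\<Sum>l\<in>{1..<i}. Y l x) ** M)"
      by (intro exp_order_diff exp_order_uminus exp_order_matrix_mult_right exp_order_sum gap)
    then obtain K where "\<forall>\<^sub>F x in at_top.
        norm (- ((Y i x - \<Phi> x ** Q i) ** M) - (\<Sum>l\<in>{1..<i}. Y l x) ** M) \<le> K * exp (\<mu> * x)"
      unfolding exp_order_def by blast
    then have "\<forall>\<^sub>F x in at_top. norm (\<Phi> x ** Q i ** M) \<le> K * exp (\<mu> * x)"
      using eventually_ge_at_top[of 0] by eventually_elim (simp only: eq)
    then have "exp_order \<mu> (\<lambda>x. \<Phi> x ** Q i ** M)"
      unfolding exp_order_def by blast
    then show ?case
      by (rule zero_of_exp_order_less_lower_bohl[OF gap(2) Q_idem[OF i] gap(1)])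
  qed
  then have "Plt j ** M = 0" by (simp add: mm.sum_left)
  with PM show ?thesis by simp
qed

text \<open>\<open>Z\<close> and \<open>Y j\<close> need not have order \<mu>, but their difference
  does, as both share the leading term \<open>\<Phi> x ** Q j\<close>. For \<open>j = 1\<close> the
  sum is empty and the initial values agree.\<close>

lemma jost_difference:
  assumes j: "j \<in> {1..m}" and Y: "\<And>i. i \<in> {1..j} \<Longrightarrow> jost (Q i) (Y i)" and Z: "jost (Q j) Z"
  shows "\<exists>M. Plt j ** M = M \<and> M ** Q j = M \<and> Z 0 = Y j 0 + (\<Sum>i\<in>{1..<j}. Y i 0) ** M"
proof -
  obtain \<alpha> \<mu> \<beta> where gap: "\<alpha> < \<mu>" "\<mu> < \<beta>"
    "\<And>i. i \<in> {1..<j} \<Longrightarrow> upper_bohl \<Phi> {0..} (Q i) < ereal \<alpha>"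
    "\<And>i. i \<in> {j..m} \<Longrightarrow> ereal \<beta> < lower_bohl \<Phi> {0..} (Q i)"
    "\<And>i. i \<in> {1..<j} \<Longrightarrow> exp_order \<mu> (Y i)"
    "exp_order \<mu> (\<lambda>x. Y j x - \<Phi> x ** Q j)" "exp_order \<mu> (\<lambda>x. Z x - \<Phi> x ** Q j)"
    by (rule jost_gap[where j = j and Y = Y and Z = Z]) (use j Y Z in \<open>assumption | blast\<close>)+
  have "\<exists>C. \<forall>p\<in>{(x, x'). 0 \<le> x' \<and> x' \<le> x}. norm (\<Sum>i\<in>{1..<j}. case p of (x, x') \<Rightarrow> \<Phi> x ** Q i ** \<Psi> x')
      \<le> C * (case p of (x, x') \<Rightarrow> exp (\<alpha> * (x - x')))"
    by (rule ex_bound_sum) (use upper_bohl_less_imp_bound[OF gap(3)] in fastforce)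
  then obtain C1 where C1: "\<And>x x'. 0 \<le> x' \<Longrightarrow> x' \<le> x \<Longrightarrow> norm (\<Phi> x ** Plt j ** \<Psi> x') \<le> C1 * exp (\<alpha> * (x - x'))"
    by (auto simp: mm.sum_left mm.sum_right)
  have "\<exists>C. \<forall>p\<in>{(x, x'). 0 \<le> x \<and> x \<le> x'}. norm (\<Sum>i\<in>{j..m}. case p of (x, x') \<Rightarrow> \<Phi> x ** Q i ** \<Psi> x')
      \<le> C * (case p of (x, x') \<Rightarrow> exp (\<beta> * (x - x')))"
    by (rule ex_bound_sum) (use less_lower_bohl_imp_bound[OF gap(4)] in fastforce)
  then obtain C2 where C2: "\<And>x x'. 0 \<le> x \<Longrightarrow> x \<le> x' \<Longrightarrow> norm (\<Phi> x ** sum Q {j..m} ** \<Psi> x') \<le> C2 * exp (\<beta> * (x - x'))"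
    by (auto simp: mm.sum_left mm.sum_right)
  have rest: "mat 1 - Plt j = sum Q {j..m}"
  proof -
    have "{1..m} = {1..<j} \<union> {j..m}" using j by auto
    then have "mat 1 = Plt j + sum Q {j..m}"
      unfolding sum_Q[symmetric] by (simp add: sum.union_disjoint ivl_disj_int)
    then show ?thesis by simp
  qed
  define C where "C = max 1 (max C1 C2)"
  have est1: "norm (\<Phi> x ** Plt j ** \<Psi> x') \<le> C * exp (\<alpha> * (x - x'))" if "0 \<le> x'" "x' \<le> x" for x x'
    by (rule order_trans[OF C1[OF that] mult_right_mono]) (auto simp: C_def)
  have est2: "norm (\<Phi> x ** (mat 1 - Plt j) ** \<Psi> x') \<le> C * exp (\<beta> * (x - x'))" if "0 \<le> x" "x \<le> x'" for x x'
    unfolding rest by (rule order_trans[OF C2[OF that] mult_right_mono]) (auto simp: C_def)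
  let ?Y = "\<lambda>x. \<Sum>i\<in>{1..<j}. Y i x" and ?W = "\<lambda>x. Z x - Y j x"
  have ordW: "exp_order \<mu> ?W"
    using exp_order_diff[OF gap(7) gap(6)] by simp
  have sols: "sol (Y i)" if "i \<in> {1..j}" for i using Y[OF that] by (simp add: jost_def)
  have "sol Z" using Z by (simp add: jost_def)
  obtain M where M: "Plt j ** M = M" "\<And>x. x \<ge> 0 \<Longrightarrow> ?W x = ?Y x ** M"
  proof (rule sol_representation[of "Plt j" C \<alpha> \<beta> \<mu> ?Y ?W])
    show "C > 0" "\<alpha> \<le> \<mu>" "\<mu> < \<beta>" using gap by (auto simp: C_def)
    show "Plt j ** Plt j = Plt j" using j by (intro P_less_idem) auto
    show "sol ?Y" by (intro sol_sum sols) auto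
    show "exp_order \<mu> ?Y" by (intro exp_order_sum gap)
    show "sol ?W" using j by (intro sol_diff sols \<open>sol Z\<close>) auto
    show "M = 0" if "Plt j ** M = M" "\<And>x. x \<ge> 0 \<Longrightarrow> ?Y x ** M = 0" for M :: "complex^'n^'n"
    proof (rule jost_nondegenerate)
      show "j \<le> Suc m" "\<And>i. i \<in> {1..<j} \<Longrightarrow> jost (Q i) (Y i)" using j Y by auto
    qed (fact that)+
  qed (use est1 est2 ordW in auto)
  \<comment> \<open>Both initial values absorb \<open>Q j\<close>, so \<open>M\<close> may be
    replaced by \<open>M ** Q j\<close>, which confines it to one block column.\<close>
  have W0: "?W 0 ** Q j = ?W 0"
    using Y[of j] Z j by (simp add: jost_def mm.diff_left)
  show ?thesis
  proof (intro exI[of _ "M ** Q j"] conjI)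
    show "Plt j ** (M ** Q j) = M ** Q j" using M(1) by (simp add: matrix_mul_assoc)
    show "M ** Q j ** Q j = M ** Q j" using Q_idem[OF j] by (simp flip: matrix_mul_assoc)
    have "?W 0 = ?Y 0 ** (M ** Q j)"
      using W0 M(2)[of 0] by (simp add: matrix_mul_assoc)
    then show "Z 0 = Y j 0 + ?Y 0 ** (M ** Q j)" by (simp add: algebra_simps)
  qed
qed

text \<open>Since \<open>Y i 0 ** M j = 0\<close> for \<open>i \<ge> j\<close>, the partial sum
  multiplying \<open>M j\<close> may be completed to the full sum; then one factor
  \<open>mat 1 + N\<close>, with \<open>N\<close> the sum of the \<open>M j\<close>, serves all
  indices. Absorption of the partial identity on both sides of \<open>N\<close> later decouples the
  two half-lines.\<close>

theorem jost_sum_unipotent: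
  assumes k: "k \<le> m" and Y: "\<And>j. j \<in> {1..k} \<Longrightarrow> jost (Q j) (Y j)" and Z: "\<And>j. j \<in> {1..k} \<Longrightarrow> jost (Q j) (Z j)"
  shows "\<exists>N. sum Q {1..k} ** N = N \<and> N ** sum Q {1..k} = N \<and> det (mat 1 + N) = 1 \<and>
    (\<Sum>j=1..k. Z j 0) = (\<Sum>j=1..k. Y j 0) ** (mat 1 + N)"
proof -
  have "\<exists>M. \<forall>j\<in>{1..k}. Plt j ** M j = M j \<and> M j ** Q j = M j \<and> Z j 0 = Y j 0 + (\<Sum>i\<in>{1..<j}. Y i 0) ** M j"
    using k Y Z by (intro bchoice ballI jost_difference) auto
  then obtain M where M: "\<And>j. j \<in> {1..k} \<Longrightarrow> Plt j ** M j = M j" "\<And>j. j \<in> {1..k} \<Longrightarrow> M j ** Q j = M j"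
    "\<And>j. j \<in> {1..k} \<Longrightarrow> Z j 0 = Y j 0 + (\<Sum>i\<in>{1..<j}. Y i 0) ** M j"
    by blast
  have orthk: "Q i ** Q j = (if i = j then Q i else 0)" if "i \<in> {1..k}" "j \<in> {1..k}" for i j
    using that k by (intro orth) auto
  let ?S = "sum Q {1..k}" and ?N = "\<Sum>j=1..k. M j"
  have left: "?S ** M j = M j" if j: "j \<in> {1..k}" for j
  proof -
    have "?S ** Plt j = Plt j"
      using sum_orthogonal_idempotents_mult[of "{1..k}" Q "{1..k}" "{1..<j}"] orthk j
      by (auto simp: Int_absorb1 subset_eq)
    then show ?thesis using M(1)[OF j] by (metis matrix_mul_assoc)
  qed
  have right: "M j ** ?S = M j" if j: "j \<in> {1..k}" for j
  proof -
    have "Q j ** ?S = Q j"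
      using sum_orthogonal_idempotents_mult[of "{1..k}" Q "{j}" "{1..k}"] orthk j by auto
    then show ?thesis using M(2)[OF j] by (metis matrix_mul_assoc)
  qed
  have tail: "Y i 0 ** M j = 0" if "j \<in> {1..k}" "i \<in> {j..k}" for i j
  proof -
    have "Q i ** Plt j = 0"
      using sum_orthogonal_idempotents_mult[of "{1..k}" Q "{i}" "{1..<j}"] orthk that by (auto simp: subset_eq)
    moreover have "Y i 0 = Y i 0 ** Q i" using Y[of i] that by (simp add: jost_def)
    ultimately show ?thesis using M(1)[OF that(1)] by (metis matrix_mul_assoc mm.zero_left mm.zero_right)
  qed
  have "Z j 0 = Y j 0 + (\<Sum>i=1..k. Y i 0) ** M j" if j: "j \<in> {1..k}" for j
  proof -
    have "{1..k} = {1..<j} \<union> {j..k}" using j by auto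
    then have "(\<Sum>i=1..k. Y i 0) = (\<Sum>i\<in>{1..<j}. Y i 0) + (\<Sum>i\<in>{j..k}. Y i 0)"
      by (simp add: sum.union_disjoint ivl_disj_int)
    moreover have "(\<Sum>i\<in>{j..k}. Y i 0) ** M j = 0" using tail[OF j] by (simp add: mm.sum_left)
    ultimately show ?thesis using M(3)[OF j] by (simp add: mm.add_left)
  qed
  then have "(\<Sum>j=1..k. Z j 0) = (\<Sum>j=1..k. Y j 0) ** (mat 1 + ?N)"
    by (simp add: sum.distrib mm.add_right mm.sum_right)
  moreover have "?S ** ?N = ?N" using left by (simp add: mm.sum_right)
  moreover have "?N ** ?S = ?N" using right by (simp add: mm.sum_left)
  moreover have "det (mat 1 + ?N) = 1" by (rule det_unipotent[of k Q M]) (use orthk M in auto)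
  ultimately show ?thesis by blast
qed

end

section \<open>Both half-lines\<close>

text \<open>A smaller set imposes fewer inequalities, so more rates are admissible and separation on
  the line passes to the half-lines.\<close>

lemma lower_bohl_antimono: "I \<subseteq> J \<Longrightarrow> lower_bohl \<Phi> J P \<le> lower_bohl \<Phi> I P"
  unfolding lower_bohl_def by (intro Sup_subset_mono image_mono) blast

lemma upper_bohl_mono: "I \<subseteq> J \<Longrightarrow> upper_bohl \<Phi> I P \<le> upper_bohl \<Phi> J P"
  unfolding upper_bohl_def by (intro Inf_superset_mono image_mono) blast

text \<open>The order of the two exponents does not restrict to half-lines: both monotonicity lemmas
  point the wrong way. Being nonzero does not refer to a set, and \<open>bohl_segment\<close>
  recovers the order from it. For \<open>P = 0\<close> all rates are admissible; 1 and 0 already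
  give a contradiction.\<close>

lemma bohl_segment_imp_nonzero:
  assumes "lower_bohl \<Phi> J P \<le> upper_bohl \<Phi> J P"
  shows "P \<noteq> 0"
proof
  assume "P = 0"
  then have "ereal 1 \<le> lower_bohl \<Phi> J P" "upper_bohl \<Phi> J P \<le> ereal 0"
    unfolding lower_bohl_def upper_bohl_def
    by (intro Sup_upper Inf_lower imageI CollectI exI[of _ 0]; simp add: mm.zero_left mm.zero_right)+
  with assms have "ereal 1 \<le> ereal 0" by (meson order_trans)
  then show False by simp
qed

section \<open>Reflection of the half-lines\<close>

lemma ball_atLeast_reflect: "(\<forall>x\<in>{0..}. P x) \<longleftrightarrow> (\<forall>x\<in>{..0}. P (- x))" for P :: "real \<Rightarrow> bool"
proof (intro iffI ballI)
  fix x :: real assume "\<forall>x\<in>{..0}. P (- x)" "x \<in> {0..}"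
  then have "P (- (- x))" by (intro bspec[where P = "\<lambda>x. P (- x)"]) auto
  then show "P x" by simp
qed simp

lemma ereal_image_uminus:
  assumes "\<And>\<kappa>. \<kappa> \<in> T \<longleftrightarrow> - \<kappa> \<in> S"
  shows "ereal ` T = uminus ` ereal ` S"
proof (intro equalityI subsetI)
  fix y assume "y \<in> ereal ` T"
  then obtain \<kappa> where "y = ereal \<kappa>" "- \<kappa> \<in> S" using assms by blast
  then show "y \<in> uminus ` ereal ` S" by (intro image_eqI[of _ _ "ereal (- \<kappa>)"]) simp_all
next
  fix y assume "y \<in> uminus ` ereal ` S"
  then obtain \<kappa> where "y = - ereal \<kappa>" "\<kappa> \<in> S" by blast
  then show "y \<in> ereal ` T" using assms[of "- \<kappa>"] by (intro image_eqI[of _ _ "- \<kappa>"]) simp_all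
qed

text \<open>Reflection reverses the order of the two points and the sign of their difference, so
  admissible rates for one exponent are the negatives of those for the other.\<close>

lemma upper_bohl_reflect: "upper_bohl (\<lambda>x. \<Phi> (- x)) {0..} P = - lower_bohl \<Phi> {..0} P"
proof -
  let ?S = "{\<kappa>. \<exists>C. \<forall>x\<in>{..0}. \<forall>x'\<in>{..0}. x \<le> x' \<longrightarrow>
      norm (\<Phi> x ** P ** matrix_inv (\<Phi> x')) \<le> C * exp (\<kappa> * (x - x'))}"
  let ?T = "{\<kappa>. \<exists>C. \<forall>x\<in>{0..}. \<forall>x'\<in>{0..}. x \<ge> x' \<longrightarrow>
      norm (\<Phi> (- x) ** P ** matrix_inv (\<Phi> (- x'))) \<le> C * exp (\<kappa> * (x - x'))}"
  have *: "\<kappa> \<in> ?T \<longleftrightarrow> - \<kappa> \<in> ?S" for \<kappa>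
  proof -
    have "(\<forall>x\<in>{0..}. \<forall>x'\<in>{0..}. x \<ge> x' \<longrightarrow>
          norm (\<Phi> (- x) ** P ** matrix_inv (\<Phi> (- x'))) \<le> C * exp (\<kappa> * (x - x'))) \<longleftrightarrow>
        (\<forall>x\<in>{..0}. \<forall>x'\<in>{..0}. x \<le> x' \<longrightarrow>
          norm (\<Phi> x ** P ** matrix_inv (\<Phi> x')) \<le> C * exp (- \<kappa> * (x - x')))" for C
      by (simp add: ball_atLeast_reflect algebra_simps)
    then show ?thesis by (simp only: mem_Collect_eq)
  qed
  from ereal_image_uminus[of ?T ?S, OF *] show ?thesis
    unfolding upper_bohl_def lower_bohl_def by (simp only: ereal_Inf_uminus_image_eq)
qed

lemma lower_bohl_reflect: "lower_bohl (\<lambda>x. \<Phi> (- x)) {0..} P = - upper_bohl \<Phi> {..0} P"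
proof -
  let ?S = "{\<kappa>. \<exists>C. \<forall>x\<in>{..0}. \<forall>x'\<in>{..0}. x \<ge> x' \<longrightarrow>
      norm (\<Phi> x ** P ** matrix_inv (\<Phi> x')) \<le> C * exp (\<kappa> * (x - x'))}"
  let ?T = "{\<kappa>. \<exists>C. \<forall>x\<in>{0..}. \<forall>x'\<in>{0..}. x \<le> x' \<longrightarrow>
      norm (\<Phi> (- x) ** P ** matrix_inv (\<Phi> (- x'))) \<le> C * exp (\<kappa> * (x - x'))}"
  have *: "\<kappa> \<in> ?T \<longleftrightarrow> - \<kappa> \<in> ?S" for \<kappa>
  proof -
    have "(\<forall>x\<in>{0..}. \<forall>x'\<in>{0..}. x \<le> x' \<longrightarrow>
          norm (\<Phi> (- x) ** P ** matrix_inv (\<Phi> (- x'))) \<le> C * exp (\<kappa> * (x - x'))) \<longleftrightarrow>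
        (\<forall>x\<in>{..0}. \<forall>x'\<in>{..0}. x \<ge> x' \<longrightarrow>
          norm (\<Phi> x ** P ** matrix_inv (\<Phi> x')) \<le> C * exp (- \<kappa> * (x - x')))" for C
      by (simp add: ball_atLeast_reflect algebra_simps)
    then show ?thesis by (simp only: mem_Collect_eq)
  qed
  from ereal_image_uminus[of ?T ?S, OF *] show ?thesis
    unfolding upper_bohl_def lower_bohl_def by (simp only: ereal_Sup_uminus_image_eq)
qed

text \<open>Were the upper exponent smaller, rates \<alpha> < \<beta> would fit in between, and
  \<open>\<Phi> x ** P\<close> would have order \<alpha> against a lower bound with rate
  \<beta>.\<close>

lemma (in half_line) bohl_segment:
  assumes "P ** P = P" "P \<noteq> 0"
  shows "lower_bohl \<Phi> {0..} P \<le> upper_bohl \<Phi> {0..} P"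
proof (rule ccontr)
  assume "\<not> ?thesis"
  then have "upper_bohl \<Phi> {0..} P < lower_bohl \<Phi> {0..} P" by (simp only: not_le)
  then obtain \<alpha> where \<alpha>: "upper_bohl \<Phi> {0..} P < ereal \<alpha>" "ereal \<alpha> < lower_bohl \<Phi> {0..} P"
    using ereal_dense2 by blast
  obtain \<beta> where \<beta>: "ereal \<alpha> < ereal \<beta>" "ereal \<beta> < lower_bohl \<Phi> {0..} P"
    using ereal_dense2[OF \<alpha>(2)] by blast
  have "P ** mat 1 = 0"
  proof (rule zero_of_exp_order_less_lower_bohl[OF \<beta>(2) assms(1)])
    show "\<alpha> < \<beta>" using \<beta>(1) by simp
    show "exp_order \<alpha> (\<lambda>x. \<Phi> x ** P ** mat 1)" using exp_order_upper_bohl[OF \<alpha>(1)] by simp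
  qed
  with \<open>P \<noteq> 0\<close> show False by simp
qed

text \<open>Reversing the variable reverses the sign of the derivative; this is the minus sign in
  \<open>- R (- x)\<close>.\<close>

lemma half_line_propagator:
  assumes A: "locally_integrable A" and \<Phi>: "propagator A \<Phi>"
    and R: "integrable lebesgue (\<lambda>x. norm (R x))"
  shows "half_line \<Phi> R" "half_line (\<lambda>x. \<Phi> (- x)) (\<lambda>x. - R (- x))"
proof -
  have inv: "invertible (\<Phi> x)" for x by (rule propagator_invertible[OF A \<Phi>])
  have sol: "matrix_solution A UNIV \<Phi>" and "\<Phi> 0 = mat 1" using \<Phi> by (auto simp: propagator_def)
  have cont: "continuous_on {a..b} \<Phi>" for a b
    using matrix_solution_continuous_on[OF sol] by simp
  have abs: "(\<lambda>x. norm (R x)) absolutely_integrable_on UNIV"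
    using R by (simp add: set_integrable_def)
  have int: "(\<lambda>x. norm (R x)) integrable_on S" if "S \<in> sets lebesgue" for S
    by (rule set_lebesgue_integral_eq_integral(1)[OF set_integrable_subset[OF abs that]]) simp
  show "half_line \<Phi> R"
    by unfold_locales (rule inv cont \<open>\<Phi> 0 = mat 1\<close> int | simp)+
  show "half_line (\<lambda>x. \<Phi> (- x)) (\<lambda>x. - R (- x))"
  proof
    show "continuous_on {0..b} (\<lambda>x. \<Phi> (- x))" for b
      by (rule continuous_on_compose2[OF cont[of "- b" 0]]) (auto intro: continuous_intros)
    have "(\<lambda>x. norm (R x)) absolutely_integrable_on {..0}"
      by (rule set_integrable_subset[OF abs]) auto
    then have "(\<lambda>x. norm (R (- x))) absolutely_integrable_on {0..}"
      by (intro conjunct1[OF iffD2[OF has_absolute_integral_reflect_real[of "{0..}" "{..0}" "\<lambda>x. norm (R x)"]]] conjI)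
        auto
    then show "(\<lambda>t. norm (- R (- t))) integrable_on {0..}"
      by (simp only: norm_minus_cancel set_lebesgue_integral_eq_integral(1))
  qed (simp_all add: inv \<open>\<Phi> 0 = mat 1\<close>)
qed

lemma jost_of_jost_plus:
  assumes A: "locally_integrable A" and \<Phi>: "propagator A \<Phi>"
    and R: "integrable lebesgue (\<lambda>x. norm (R x))" and Y: "jost_plus A R \<Phi> P Y"
  shows "half_line.jost \<Phi> R P Y"
proof -
  interpret half_line \<Phi> R by (rule half_line_propagator[OF A \<Phi> R])
  have inv: "invertible (\<Phi> x)" for x by (rule propagator_invertible[OF A \<Phi>])
  have Y': "matrix_solution (\<lambda>x. A x + R x) {0..} Y" and \<Phi>': "matrix_solution A UNIV \<Phi>"
    using Y \<Phi> by (auto simp: jost_plus_def propagator_def)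
  have "sol Y"
    unfolding sol_def
    by (intro conjI allI impI matrix_solution_continuous_on[OF Y'] variation_of_constants[OF \<Phi>' inv Y']) auto
  with Y show ?thesis unfolding jost_def jost_plus_def by blast
qed

lemma jost_of_jost_minus:
  assumes A: "locally_integrable A" and \<Phi>: "propagator A \<Phi>"
    and R: "integrable lebesgue (\<lambda>x. norm (R x))" and Y: "jost_minus A R \<Phi> P Y"
  shows "half_line.jost (\<lambda>x. \<Phi> (- x)) (\<lambda>x. - R (- x)) P (\<lambda>x. Y (- x))"
proof -
  interpret half_line "\<lambda>x. \<Phi> (- x)" "\<lambda>x. - R (- x)" by (rule half_line_propagator[OF A \<Phi> R])
  have inv: "invertible (\<Phi> x)" for x by (rule propagator_invertible[OF A \<Phi>])
  have Y': "matrix_solution (\<lambda>x. A x + R x) {..0} Y" and \<Phi>': "matrix_solution A UNIV \<Phi>"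
    using Y \<Phi> by (auto simp: jost_minus_def propagator_def)
  have "sol (\<lambda>x. Y (- x))"
    unfolding sol_def
  proof (intro conjI allI impI)
    show "continuous_on {0..b} (\<lambda>x. Y (- x))" for b
      by (rule continuous_on_compose2[OF matrix_solution_continuous_on[OF Y', of "- b" 0]])
        (auto intro: continuous_intros)
    fix a b :: real assume ab: "0 \<le> a" "a \<le> b"
    let ?f = "\<lambda>t. matrix_inv (\<Phi> t) ** R t ** Y t" and ?V = "\<lambda>t. matrix_inv (\<Phi> t) ** Y t"
    have "(?f has_integral ?V (- a) - ?V (- b)) {- b..- a}"
      using ab by (intro variation_of_constants[OF \<Phi>' inv Y']) auto
    then have "((\<lambda>t. ?f (- t)) has_integral ?V (- a) - ?V (- b)) {a..b}"
      using has_integral_reflect_real[of ?f _ "- a" "- b"] by simp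
    \<comment> \<open>The sign compensates for the reversed orientation of the integral and becomes
      the sign of the reflected perturbation.\<close>
    then have "((\<lambda>t. - ?f (- t)) has_integral - (?V (- a) - ?V (- b))) {a..b}"
      by (rule has_integral_neg)
    then show "((\<lambda>t. matrix_inv (\<Phi> (- t)) ** - R (- t) ** Y (- t)) has_integral ?V (- b) - ?V (- a)) {a..b}"
      by (simp add: mm.minus_left mm.minus_right)
  qed
  moreover have "Limsup at_top (\<lambda>x. ereal (1 / x) * log_ereal (norm (Y (- x) - \<Phi> (- x) ** P)))
      < lower_bohl (\<lambda>x. \<Phi> (- x)) {0..} P"
  proof -
    \<comment> \<open>The factor \<open>1 / x\<close> changes sign under reflection, which turns the
      lower limit at minus infinity into the negative of an upper limit at infinity.\<close>
    define h where "h x = ereal (1 / x) * log_ereal (norm (Y x - \<Phi> x ** P))" for x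
    have "Liminf at_bot h = Liminf at_top (\<lambda>x. h (- x))"
      unfolding at_bot_mirror by (rule Liminf_filtermap_eq) (simp add: inj_def)
    moreover have "(\<lambda>x. ereal (1 / x) * log_ereal (norm (Y (- x) - \<Phi> (- x) ** P))) = (\<lambda>x. - h (- x))"
    proof
      fix x :: real
      have "ereal (1 / (- x)) = - ereal (1 / x)" by simp
      then show "ereal (1 / x) * log_ereal (norm (Y (- x) - \<Phi> (- x) ** P)) = - h (- x)"
        unfolding h_def by (simp only: ereal_mult_minus_left ereal_uminus_uminus)
    qed
    moreover have "upper_bohl \<Phi> {..0} P < Liminf at_bot h"
      using Y unfolding jost_minus_def h_def by blast
    ultimately show ?thesis
      by (simp only: ereal_Limsup_uminus lower_bohl_reflect ereal_minus_less_minus)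
  qed
  moreover have "Y (- 0) = Y (- 0) ** P" using Y unfolding jost_minus_def by simp
  ultimately show ?thesis unfolding jost_def by blast
qed

theorem lemma7p6:
  fixes A R \<Phi> :: "real \<Rightarrow> complex^'n^'n"
    and Q :: "complex^'n^'n"
    and Qs :: "nat \<Rightarrow> complex^'n^'n"
    and d' k\<^sub>0 :: nat
    and Yp Zp Ym Zm :: "nat \<Rightarrow> real \<Rightarrow> complex^'n^'n"
  assumes "CARD('n) \<ge> 2"
    and "locally_integrable A"
    and "propagator A \<Phi>"
    and "exp_bounded \<Phi>"
    and "exp_dichotomy \<Phi> Q"
    and "2 \<le> d'" and "d' \<le> CARD('n)"
    and "1 \<le> k\<^sub>0" and "k\<^sub>0 \<le> d' - 1"
    and "exp_splitting \<Phi> {1..d'} Qs"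
    and "Q = (\<Sum>j=1..k\<^sub>0. Qs j)"
    and "mat 1 - Q = (\<Sum>j=k\<^sub>0 + 1..d'. Qs j)"
    and "\<And>j. 1 \<le> j \<Longrightarrow> j \<le> d' - 1 \<Longrightarrow>
           lower_bohl \<Phi> UNIV (Qs j) \<le> upper_bohl \<Phi> UNIV (Qs j) \<and>
           upper_bohl \<Phi> UNIV (Qs j) < lower_bohl \<Phi> UNIV (Qs (j + 1)) \<and>
           lower_bohl \<Phi> UNIV (Qs (j + 1)) \<le> upper_bohl \<Phi> UNIV (Qs (j + 1))"
    and "R \<in> borel_measurable lebesgue"
    and "integrable lebesgue (\<lambda>x. norm (R x))"
    and "jost_system A R \<Phi> Qs k\<^sub>0 d' Yp Ym"
    and "jost_system A R \<Phi> Qs k\<^sub>0 d' Zp Zm"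
  shows "evans_det k\<^sub>0 d' Yp Ym = evans_det k\<^sub>0 d' Zp Zm"
proof -
  note A = assms(2) and \<Phi> = assms(3) and R = assms(15) and chain = assms(13)
  have kd: "k\<^sub>0 < d'" using assms(6,9) by simp
  have orth: "Qs i ** Qs j = (if i = j then Qs i else 0)" if "i \<in> {1..d'}" "j \<in> {1..d'}" for i j
    using assms(10) that by (auto simp: exp_splitting_def is_projection_def)
  have sum1: "sum Qs {1..d'} = mat 1" using assms(10) by (simp add: exp_splitting_def)
  \<comment> \<open>The last index occurs in the chain only as a right neighbour, hence the instance
    at \<open>j - 1\<close>.\<close>
  have segment: "lower_bohl \<Phi> UNIV (Qs j) \<le> upper_bohl \<Phi> UNIV (Qs j)" if "j \<in> {1..d'}" for j
    using chain[of j] chain[of "j - 1"] that assms(6) by (cases "j = d'") auto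
  have separated: "upper_bohl \<Phi> UNIV (Qs i) < lower_bohl \<Phi> UNIV (Qs j)" if "1 \<le> i" "i < j" "j \<le> d'" for i j
    using Suc_leI[OF that(2)] that(3)
  proof (induction j rule: dec_induct)
    case base
    then show ?case using chain[of i] that(1) by simp
  next
    case (step j)
    then have "upper_bohl \<Phi> UNIV (Qs i) < lower_bohl \<Phi> UNIV (Qs j)" by simp
    also have "\<dots> \<le> upper_bohl \<Phi> UNIV (Qs j)" using step that(1) by (intro segment) auto
    also have "\<dots> < lower_bohl \<Phi> UNIV (Qs (Suc j))" using chain[of j] step that(1) by simp
    finally show ?case .
  qed
  have nonzero: "Qs j \<noteq> 0" if "j \<in> {1..d'}" for j
    using bohl_segment_imp_nonzero[OF segment[OF that]] .
  interpret pos: half_line \<Phi> R by (rule half_line_propagator[OF A \<Phi> R])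
  interpret neg: half_line "\<lambda>x. \<Phi> (- x)" "\<lambda>x. - R (- x)" by (rule half_line_propagator[OF A \<Phi> R])
  \<comment> \<open>Reflection reverses the order of the exponents, so the splitting is listed backwards.\<close>
  define r where "r i = Suc d' - i" for i
  have r: "r i \<in> {1..d'}" if "i \<in> {1..d'}" for i using that by (auto simp: r_def)
  interpret pos: half_line_splitting \<Phi> R Qs d'
  proof
    fix i j assume ij: "1 \<le> i" "i < j" "j \<le> d'"
    have "upper_bohl \<Phi> {0..} (Qs i) \<le> upper_bohl \<Phi> UNIV (Qs i)" by (rule upper_bohl_mono) simp
    also have "\<dots> < lower_bohl \<Phi> UNIV (Qs j)" using ij by (rule separated)
    also have "\<dots> \<le> lower_bohl \<Phi> {0..} (Qs j)" by (rule lower_bohl_antimono) simp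
    finally show "upper_bohl \<Phi> {0..} (Qs i) < lower_bohl \<Phi> {0..} (Qs j)" .
  qed (use orth sum1 nonzero in \<open>auto intro!: pos.bohl_segment\<close>)
  interpret neg: half_line_splitting "\<lambda>x. \<Phi> (- x)" "\<lambda>x. - R (- x)" "\<lambda>i. Qs (r i)" d'
  proof
    fix i j assume ij: "1 \<le> i" "i < j" "j \<le> d'"
    have "upper_bohl \<Phi> {..0} (Qs (r j)) \<le> upper_bohl \<Phi> UNIV (Qs (r j))" by (rule upper_bohl_mono) simp
    also have "\<dots> < lower_bohl \<Phi> UNIV (Qs (r i))" using ij by (intro separated) (auto simp: r_def)
    also have "\<dots> \<le> lower_bohl \<Phi> {..0} (Qs (r i))" by (rule lower_bohl_antimono) simp
    finally show "upper_bohl (\<lambda>x. \<Phi> (- x)) {0..} (Qs (r i)) < lower_bohl (\<lambda>x. \<Phi> (- x)) {0..} (Qs (r j))"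
      by (simp add: upper_bohl_reflect lower_bohl_reflect)
  next
    show "(\<Sum>i = 1..d'. Qs (r i)) = mat 1"
      unfolding sum1[symmetric] by (rule sum.reindex_bij_witness[of _ r r]) (auto simp: r_def)
  next
    fix i j assume ij: "i \<in> {1..d'}" "j \<in> {1..d'}"
    then show "Qs (r i) ** Qs (r j) = (if i = j then Qs (r i) else 0)"
      using orth[OF r r, of i j] by (auto simp: r_def)
  next
    fix i assume "i \<in> {1..d'}"
    then show "lower_bohl (\<lambda>x. \<Phi> (- x)) {0..} (Qs (r i)) \<le> upper_bohl (\<lambda>x. \<Phi> (- x)) {0..} (Qs (r i))"
      using orth[OF r r, of i i] nonzero[OF r] by (intro neg.bohl_segment) auto
  qed
  let ?P = "sum Qs {1..k\<^sub>0}" and ?P' = "sum Qs {k\<^sub>0 + 1..d'}"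
  \<comment> \<open>\<open>r\<close> is an involution on the indices and exchanges
    \<open>{1..d' - k\<^sub>0}\<close> with \<open>{k\<^sub>0 + 1..d'}\<close>.\<close>
  have shift: "(\<Sum>j=1..d' - k\<^sub>0. f (r j)) = (\<Sum>j=k\<^sub>0 + 1..d'. f j)" for f :: "nat \<Rightarrow> complex^'n^'n"
    by (rule sum.reindex_bij_witness[of _ r r]) (use kd in \<open>auto simp: r_def\<close>)
  have plus: "jost_plus A R \<Phi> (Qs j) (Yp j)" "jost_plus A R \<Phi> (Qs j) (Zp j)" if "j \<in> {1..k\<^sub>0}" for j
    using assms(16,17) that unfolding jost_system_def by blast+
  have minus: "jost_minus A R \<Phi> (Qs j) (Ym j)" "jost_minus A R \<Phi> (Qs j) (Zm j)" if "j \<in> {k\<^sub>0 + 1..d'}" for j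
    using assms(16,17) that unfolding jost_system_def by blast+
  have "\<exists>N. ?P ** N = N \<and> N ** ?P = N \<and> det (mat 1 + N) = 1 \<and>
      (\<Sum>j=1..k\<^sub>0. Zp j 0) = (\<Sum>j=1..k\<^sub>0. Yp j 0) ** (mat 1 + N)"
    using kd by (intro pos.jost_sum_unipotent jost_of_jost_plus[OF A \<Phi> R] plus) auto
  then obtain N where N: "?P ** N = N" "N ** ?P = N" "det (mat 1 + N) = 1"
    "(\<Sum>j=1..k\<^sub>0. Zp j 0) = (\<Sum>j=1..k\<^sub>0. Yp j 0) ** (mat 1 + N)"
    by blast
  have "\<exists>N. sum (\<lambda>i. Qs (r i)) {1..d' - k\<^sub>0} ** N = N \<and> N ** sum (\<lambda>i. Qs (r i)) {1..d' - k\<^sub>0} = N \<and>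
      det (mat 1 + N) = 1 \<and>
      (\<Sum>j=1..d' - k\<^sub>0. Zm (r j) (- 0)) = (\<Sum>j=1..d' - k\<^sub>0. Ym (r j) (- 0)) ** (mat 1 + N)"
  proof (rule neg.jost_sum_unipotent[where Y = "\<lambda>j x. Ym (r j) (- x)" and Z = "\<lambda>j x. Zm (r j) (- x)"])
    fix j assume "j \<in> {1..d' - k\<^sub>0}"
    then have j: "r j \<in> {k\<^sub>0 + 1..d'}" using kd by (auto simp: r_def)
    show "neg.jost (Qs (r j)) (\<lambda>x. Ym (r j) (- x))" "neg.jost (Qs (r j)) (\<lambda>x. Zm (r j) (- x))"
      by (intro jost_of_jost_minus[OF A \<Phi> R] minus j)+
  qed simp
  then obtain N' where N': "?P' ** N' = N'" "N' ** ?P' = N'" "det (mat 1 + N') = 1"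
    "(\<Sum>j=k\<^sub>0 + 1..d'. Zm j 0) = (\<Sum>j=k\<^sub>0 + 1..d'. Ym j 0) ** (mat 1 + N')"
    unfolding minus_zero shift[of Qs] shift[of "\<lambda>j. Ym j 0"] shift[of "\<lambda>j. Zm j 0"] by blast
  have PP': "?P ** ?P' = 0" "?P' ** ?P = 0"
    using sum_orthogonal_idempotents_mult[of "{1..d'}" Qs "{1..k\<^sub>0}" "{k\<^sub>0 + 1..d'}"]
      sum_orthogonal_idempotents_mult[of "{1..d'}" Qs "{k\<^sub>0 + 1..d'}" "{1..k\<^sub>0}"] orth kd
    by (auto simp: subset_eq)
  let ?Y = "\<Sum>j=1..k\<^sub>0. Yp j 0" and ?Y' = "\<Sum>j=k\<^sub>0 + 1..d'. Ym j 0"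
  have absorb: "(\<Sum>j\<in>B. W j 0) ** sum Qs B = (\<Sum>j\<in>B. W j 0)"
    if "B \<subseteq> {1..d'}" and W: "\<And>j. j \<in> B \<Longrightarrow> W j 0 = W j 0 ** Qs j" for B and W :: "nat \<Rightarrow> real \<Rightarrow> complex^'n^'n"
  proof -
    have "W j 0 ** sum Qs B = W j 0" if j: "j \<in> B" for j
    proof -
      have "Qs j ** sum Qs B = Qs j"
        using sum_orthogonal_idempotents_mult[of "{1..d'}" Qs "{j}" B] orth \<open>B \<subseteq> {1..d'}\<close> j
        by auto
      then show ?thesis using W[OF j] by (metis matrix_mul_assoc)
    qed
    then show ?thesis by (simp add: mm.sum_left)
  qed
  have YP: "?Y ** ?P = ?Y"
    by (rule absorb) (use kd plus(1) in \<open>auto simp: jost_plus_def\<close>)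
  have YP': "?Y' ** ?P' = ?Y'"
    by (rule absorb) (use minus(1) in \<open>auto simp: jost_minus_def\<close>)
  \<comment> \<open>The data of one half-line are absorbed by \<open>?P\<close>, those of the other
    by \<open>?P'\<close>, and these annihilate each other. So each factor leaves the other summand
    alone, and the product of both transforms the two sums simultaneously.\<close>
  have YN': "?Y ** N' = 0"
    by (metis N'(1) PP'(1) YP matrix_mul_assoc mm.zero_left mm.zero_right)
  have YN: "?Y' ** N = 0"
    by (metis N(1) PP'(2) YP' matrix_mul_assoc mm.zero_left mm.zero_right)
  have NN': "N ** N' = 0"
    by (metis N(2) N'(1) PP'(1) matrix_mul_assoc mm.zero_left mm.zero_right)
  have NN: "(mat 1 + N) ** (mat 1 + N') = mat 1 + N + N'"
    by (simp add: mm.add_left mm.add_right NN')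
  have "(?Y + ?Y') ** ((mat 1 + N) ** (mat 1 + N')) = ?Y ** (mat 1 + N) + ?Y' ** (mat 1 + N')"
    unfolding NN unfolding mm.add_left mm.add_right YN YN' by (simp add: add.assoc add.left_commute)
  then show ?thesis
    unfolding evans_det_def N(4) N'(4) by (metis N(3) N'(3) det_mul mult.right_neutral)
qed

end
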